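(* Let $\mathsf{queryMonCF}$, $\mathsf{insertMonCF}$ and $\mathsf{removeMonCF}$ be the operations of the compatibility-forest data structure $\mathsf{MonCF}$ described in the context. Applied to any sequence of insert, remove and query operations starting from the empty set, during which the current interval set is monotonic at all times, these algorithms solve the dynamic monotonic interval scheduling problem: every query$(i)$ returns $\mathsf{true}$ if and only if $i$ belongs to the greedy optimal set of the current interval set $I$. Moreover, insertion and removal of an interval take $O(\log^2 n)$ amortised time and a query takes $O(\log n)$ amortised time, where $n$ is the size of the set $I$ of intervals.
   Context: An interval $i$ is a pair $(s(i),f(i))\in\mathbb{R}^2$ with $s(i)<f(i)$. Intervals $i,j$ are compatible if $f(i)<s(j)$ or $f(j)<s(i)$; otherwise they overlap. Intervals in a set $I$ have pairwise distinct finishing times, and $\preceq$ denotes the ordering by finishing time ("least", "next", "previous" refer to $\preceq$). The greedy optimal set $J=\{i_1,i_2,\dots\}$ of $I$ is defined by: $i_1$ is the least interval of $I$, and $i_{k+1}$ is the least interval with $i_k\prec i_{k+1}$ compatible with $i_k$. The set $I$ is monotonic if no interval of $I$ properly contains another. For $i\in I$, the right compatible interval $\mathsf{rc}(i)$ is the least $j\in I$ with $i\prec j$ compatible with $i$ (if it exists). The dynamic monotonic interval scheduling problem: process an arbitrary sequence of operations $\mathsf{insert}(i)$, $\mathsf{remove}(i)$, $\mathsf{query}(i)$ on a changing set $I$, where $\mathsf{query}(i)$ must return $\mathsf{true}$ iff $i$ is in the greedy optimal set of the current $I$. The compatibility forest $\mathcal{F}(I)$ has node set $I$ and an edge from $i$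 to its parent $\mathsf{rc}(i)$. The data structure $\mathsf{MonCF}$ consists of: (1) a balanced binary search tree $T(I)$ on $I$ ordered by starting time (which equals $\preceq$ for monotonic sets), supporting in addition the operation $\mathsf{right\_compatible}(i)$ which walks down from the root, going to the right child when the current node $j$ satisfies $j\preceq i$ or overlaps $i$, and otherwise recording $j$ and going to the left child, returning the last recorded node (or $\mathsf{nil}$); (2) a partition of the edges of $\mathcal{F}(I)$ into solid and dashed edges such that each node has at most one incoming solid edge; each maximal solid path is stored as a splay tree ordered by $\preceq$ (supporting insert, delete, find, predecessor, maximum, join, and split at $u$ into $L(u)=\{x<u\}$ and $R(u)=\{x\ge u\}$, all in $O(\log n)$ amortised time); $\mathrm{ST}_i$ denotes the splay tree containing $i$. $\mathsf{expose}(i)$: let $j=\max(\mathrm{ST}_i)$ and $i'=\mathsf{right\_compatible}(j)$; while $i'\ne\mathsf{nil}$: split $\mathrm{ST}_{i'}$ at $i'$, join $\mathrm{ST}_i$ with $R(i')$, set $j=\max(\mathrm{ST}_{i'})$, $i'=\mathsf{right\_compatible}(j)$. $\mathsf{queryMonCF}(i)$: let $m$ be the minimum of $T(I)$; return whether $i\in\mathrm{ST}_m$. $\mathsf{insertMonCF}(i)$: insert $i$ into $T(I)$; let $r$ be the next interval of $i$; if $r$ exists, let $j$ be the predecessor of $r$ in $\mathrm{ST}_r$, and if $j$ exists and is compatible with $i$, split $\mathrm{ST}_r$ at $r$; finally call $\mathsf{expose}$ on the minimum of $T(I)$. $\mathsf{removeMonCF}(i)$: delete $i$ from $\mathrm{ST}_i$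 and from $T(I)$; call $\mathsf{expose}$ on the minimum of $T(I)$.
   Formalization: In removeMonCF, deleting i from ST_i is taken to split the solid path into the parts before and after i, kept as separate trees; with ordinary splay-tree deletion, which joins them, queries can be wrong: insert (0,1),(2,5),(3,6),(5.5,7), remove (2,5), query (5.5,7). *)

theory Defs
  imports Complex_Main "HOL-Library.Tree" "HOL-Library.While_Combinator"
    "HOL-Library.Landau_Symbols"
begin

section \<open>Dynamic interval scheduling\<close>

type_synonym interval = "real \<times> real"

abbreviation start :: "interval \<Rightarrow> real" where "start \<equiv> fst"
abbreviation finish :: "interval \<Rightarrow> real" where "finish \<equiv> snd"

definition compatible :: "interval \<Rightarrow> interval \<Rightarrow> bool" where
  "compatible i j \<longleftrightarrow> finish i < start j \<or> finish j < start i"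

definition prec :: "interval \<Rightarrow> interval \<Rightarrow> bool"  (infix \<open>\<prec>\<close> 50) where
  "i \<prec> j \<longleftrightarrow> finish i < finish j"

definition interval_set :: "interval set \<Rightarrow> bool" where
  "interval_set I \<longleftrightarrow> (\<forall>i\<in>I. start i < finish i) \<and> inj_on finish I"

text \<open>Proper containment is that of closed intervals, so two different intervals with the same
  starting time are not allowed in a monotonic set.\<close>

definition monotonic :: "interval set \<Rightarrow> bool" where
  "monotonic I \<longleftrightarrow>
     \<not> (\<exists>i\<in>I. \<exists>j\<in>I. {start j..finish j} \<subset> {start i..finish i})"

definition is_rc :: "interval set \<Rightarrow> interval \<Rightarrow> interval \<Rightarrow> bool" where
  "is_rc I i j \<longleftrightarrow> is_arg_min finish (\<lambda>j. j \<in> I \<and> i \<prec> j \<and> compatible i j) j"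

inductive_set greedy :: "interval set \<Rightarrow> interval set" for I where
  first: "is_arg_min finish (\<lambda>i. i \<in> I) i \<Longrightarrow> i \<in> greedy I"
| later: "i \<in> greedy I \<Longrightarrow> is_rc I i j \<Longrightarrow> j \<in> greedy I"

datatype operation = Insert interval | Remove interval | Query interval

fun apply_op :: "operation \<Rightarrow> interval set \<Rightarrow> interval set" where
  "apply_op (Insert i) I = insert i I"
| "apply_op (Remove i) I = I - {i}"
| "apply_op (Query i) I = I"

definition current_set :: "operation list \<Rightarrow> interval set" where
  "current_set ops = fold apply_op ops {}"


section \<open>The balanced search tree \<open>T(I)\<close>\<close>

text \<open>An AVL tree ordered by starting time; every node stores its height. Functions whose name
  begins with \<open>T_\<close> are running times: they count the nodes visited (including the empty tree at
  the end of a search), as the work done at a node is constant.\<close>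

type_synonym avl = "(interval \<times> nat) tree"

fun ht :: "avl \<Rightarrow> nat" where
  "ht \<langle>\<rangle> = 0"
| "ht \<langle>l, (a, h), r\<rangle> = h"

definition node :: "avl \<Rightarrow> interval \<Rightarrow> avl \<Rightarrow> avl" where
  "node l a r = \<langle>l, (a, max (ht l) (ht r) + 1), r\<rangle>"

definition bal :: "avl \<Rightarrow> interval \<Rightarrow> avl \<Rightarrow> avl" where
  "bal l a r =
    (if ht l > ht r + 1 then
       (case l of \<langle>ll, (b, _), lr\<rangle> \<Rightarrow>
          if ht ll \<ge> ht lr then node ll b (node lr a r)
          else (case lr of \<langle>x, (c, _), y\<rangle> \<Rightarrow> node (node ll b x) c (node y a r)))
     else if ht r > ht l + 1 then
       (case r of \<langle>rl, (b, _), rr\<rangle> \<Rightarrow>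
          if ht rr \<ge> ht rl then node (node l a rl) b rr
          else (case rl of \<langle>x, (c, _), y\<rangle> \<Rightarrow> node (node l a x) c (node y b rr)))
     else node l a r)"

fun avl_insert :: "interval \<Rightarrow> avl \<Rightarrow> avl" where
  "avl_insert i \<langle>\<rangle> = node \<langle>\<rangle> i \<langle>\<rangle>"
| "avl_insert i \<langle>l, (a, h), r\<rangle> =
    (if start i < start a then bal (avl_insert i l) a r
     else if start a < start i then bal l a (avl_insert i r)
     else \<langle>l, (a, h), r\<rangle>)"

fun T_avl_insert :: "interval \<Rightarrow> avl \<Rightarrow> nat" where
  "T_avl_insert i \<langle>\<rangle> = 1"
| "T_avl_insert i \<langle>l, (a, h), r\<rangle> = 1 +
    (if start i < start a then T_avl_insert i l
     else if start a < start i then T_avl_insert i r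
     else 0)"

fun avl_split_max :: "avl \<Rightarrow> avl \<times> interval" where
  "avl_split_max \<langle>l, (a, h), r\<rangle> =
    (if r = \<langle>\<rangle> then (l, a) else let (r', m) = avl_split_max r in (bal l a r', m))"

fun T_avl_split_max :: "avl \<Rightarrow> nat" where
  "T_avl_split_max \<langle>\<rangle> = 1"
| "T_avl_split_max \<langle>l, (a, h), r\<rangle> = 1 + (if r = \<langle>\<rangle> then 0 else T_avl_split_max r)"

fun avl_delete :: "interval \<Rightarrow> avl \<Rightarrow> avl" where
  "avl_delete i \<langle>\<rangle> = \<langle>\<rangle>"
| "avl_delete i \<langle>l, (a, h), r\<rangle> =
    (if start i < start a then bal (avl_delete i l) a r
     else if start a < start i then bal l a (avl_delete i r)
     else if i = a then
       (if l = \<langle>\<rangle> then r else let (l', m) = avl_split_max l in bal l' m r)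
     else \<langle>l, (a, h), r\<rangle>)"

fun T_avl_delete :: "interval \<Rightarrow> avl \<Rightarrow> nat" where
  "T_avl_delete i \<langle>\<rangle> = 1"
| "T_avl_delete i \<langle>l, (a, h), r\<rangle> = 1 +
    (if start i < start a then T_avl_delete i l
     else if start a < start i then T_avl_delete i r
     else if i = a then (if l = \<langle>\<rangle> then 0 else T_avl_split_max l)
     else 0)"

fun tree_min :: "avl \<Rightarrow> interval option" where
  "tree_min \<langle>\<rangle> = None"
| "tree_min \<langle>l, (a, h), r\<rangle> = (if l = \<langle>\<rangle> then Some a else tree_min l)"

fun T_tree_min :: "avl \<Rightarrow> nat" where
  "T_tree_min \<langle>\<rangle> = 1"
| "T_tree_min \<langle>l, (a, h), r\<rangle> = 1 + (if l = \<langle>\<rangle> then 0 else T_tree_min l)"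

text \<open>In the two searches below, the last argument is the node recorded so far.\<close>

fun next_from :: "interval \<Rightarrow> avl \<Rightarrow> interval option \<Rightarrow> interval option" where
  "next_from i \<langle>\<rangle> rec = rec"
| "next_from i \<langle>l, (j, h), r\<rangle> rec =
    (if i \<prec> j then next_from i l (Some j) else next_from i r rec)"

fun T_next_interval :: "interval \<Rightarrow> avl \<Rightarrow> nat" where
  "T_next_interval i \<langle>\<rangle> = 1"
| "T_next_interval i \<langle>l, (j, h), r\<rangle> = 1 +
    (if i \<prec> j then T_next_interval i l else T_next_interval i r)"

definition next_interval :: "interval \<Rightarrow> avl \<Rightarrow> interval option" where
  "next_interval i T = next_from i T None"

fun rc_from :: "interval \<Rightarrow> avl \<Rightarrow> interval option \<Rightarrow> interval option" where
  "rc_from i \<langle>\<rangle> rec = rec"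
| "rc_from i \<langle>l, (j, h), r\<rangle> rec =
    (if \<not> i \<prec> j \<or> \<not> compatible i j then rc_from i r rec else rc_from i l (Some j))"

fun T_right_compatible :: "interval \<Rightarrow> avl \<Rightarrow> nat" where
  "T_right_compatible i \<langle>\<rangle> = 1"
| "T_right_compatible i \<langle>l, (j, h), r\<rangle> = 1 +
    (if \<not> i \<prec> j \<or> \<not> compatible i j then T_right_compatible i r else T_right_compatible i l)"

definition right_compatible :: "interval \<Rightarrow> avl \<Rightarrow> interval option" where
  "right_compatible i T = rc_from i T None"


section \<open>Splay trees ordered by finishing time\<close>

text \<open>\<open>splay k t\<close> moves the node with finishing time \<open>k\<close> to the root by zig, zig-zig and zig-zag
  steps; if there is none, it moves up the last node on the search path.\<close>

fun splay :: "real \<Rightarrow> interval tree \<Rightarrow> interval tree" where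
  "splay k \<langle>\<rangle> = \<langle>\<rangle>"
| "splay k \<langle>l, a, r\<rangle> =
    (if k < finish a then
       (case l of
          \<langle>\<rangle> \<Rightarrow> \<langle>l, a, r\<rangle>
        | \<langle>ll, b, lr\<rangle> \<Rightarrow>
            if k < finish b \<and> ll \<noteq> \<langle>\<rangle> then
              (case splay k ll of \<langle>x, c, y\<rangle> \<Rightarrow> \<langle>x, c, \<langle>y, b, \<langle>lr, a, r\<rangle>\<rangle>\<rangle>)
            else if finish b < k \<and> lr \<noteq> \<langle>\<rangle> then
              (case splay k lr of \<langle>x, c, y\<rangle> \<Rightarrow> \<langle>\<langle>ll, b, x\<rangle>, c, \<langle>y, a, r\<rangle>\<rangle>)
            else \<langle>ll, b, \<langle>lr, a, r\<rangle>\<rangle>)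
     else if finish a < k then
       (case r of
          \<langle>\<rangle> \<Rightarrow> \<langle>l, a, r\<rangle>
        | \<langle>rl, b, rr\<rangle> \<Rightarrow>
            if finish b < k \<and> rr \<noteq> \<langle>\<rangle> then
              (case splay k rr of \<langle>x, c, y\<rangle> \<Rightarrow> \<langle>\<langle>\<langle>l, a, rl\<rangle>, b, x\<rangle>, c, y\<rangle>)
            else if k < finish b \<and> rl \<noteq> \<langle>\<rangle> then
              (case splay k rl of \<langle>x, c, y\<rangle> \<Rightarrow> \<langle>\<langle>l, a, x\<rangle>, c, \<langle>y, b, rr\<rangle>\<rangle>)
            else \<langle>\<langle>l, a, rl\<rangle>, b, rr\<rangle>)
     else \<langle>l, a, r\<rangle>)"

text \<open>Running times of splaying count 2 for the two nodes passed in a zig-zig or zig-zag step.\<close>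

fun T_splay :: "real \<Rightarrow> interval tree \<Rightarrow> nat" where
  "T_splay k \<langle>\<rangle> = 1"
| "T_splay k \<langle>l, a, r\<rangle> =
    (if k < finish a then
       (case l of
          \<langle>\<rangle> \<Rightarrow> 1
        | \<langle>ll, b, lr\<rangle> \<Rightarrow>
            if k < finish b \<and> ll \<noteq> \<langle>\<rangle> then 2 + T_splay k ll
            else if finish b < k \<and> lr \<noteq> \<langle>\<rangle> then 2 + T_splay k lr
            else 2)
     else if finish a < k then
       (case r of
          \<langle>\<rangle> \<Rightarrow> 1
        | \<langle>rl, b, rr\<rangle> \<Rightarrow>
            if finish b < k \<and> rr \<noteq> \<langle>\<rangle> then 2 + T_splay k rr
            else if k < finish b \<and> rl \<noteq> \<langle>\<rangle> then 2 + T_splay k rl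
            else 2)
     else 1)"

fun splay_max :: "interval tree \<Rightarrow> interval tree" where
  "splay_max \<langle>\<rangle> = \<langle>\<rangle>"
| "splay_max \<langle>l, a, \<langle>\<rangle>\<rangle> = \<langle>l, a, \<langle>\<rangle>\<rangle>"
| "splay_max \<langle>l, a, \<langle>rl, b, rr\<rangle>\<rangle> =
    (if rr = \<langle>\<rangle> then \<langle>\<langle>l, a, rl\<rangle>, b, \<langle>\<rangle>\<rangle>
     else (case splay_max rr of \<langle>x, c, y\<rangle> \<Rightarrow> \<langle>\<langle>\<langle>l, a, rl\<rangle>, b, x\<rangle>, c, y\<rangle>))"

fun T_splay_max :: "interval tree \<Rightarrow> nat" where
  "T_splay_max \<langle>\<rangle> = 1"
| "T_splay_max \<langle>l, a, \<langle>\<rangle>\<rangle> = 1"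
| "T_splay_max \<langle>l, a, \<langle>rl, b, rr\<rangle>\<rangle> = 2 + (if rr = \<langle>\<rangle> then 0 else T_splay_max rr)"

definition root_of :: "interval tree \<Rightarrow> interval option" where
  "root_of t = (case t of \<langle>\<rangle> \<Rightarrow> None | \<langle>l, a, r\<rangle> \<Rightarrow> Some a)"


section \<open>The collection of solid paths\<close>

text \<open>
  The solid edges are represented only by the splay trees: one tree for every maximal solid path,
  a node without solid edges forming a path of its own. The order of the trees in the list is
  irrelevant.

  A node \<open>i\<close> of \<open>T(I)\<close> carries a pointer to the node of \<open>i\<close> in \<open>ST\<^sub>i\<close>, and splay tree nodes have
  parent pointers. Going from \<open>i\<close> to the root of \<open>ST\<^sub>i\<close> therefore costs one splay at \<open>i\<close>, which
  every operation on \<open>ST\<^sub>i\<close> below performs first and is charged for; the membership tests in \<open>ST\<close>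
  and \<open>update\<close> only select that tree and are not steps of the algorithm.

  Operations return their results paired with the running time.
\<close>

type_synonym paths = "interval tree list"

definition ST :: "paths \<Rightarrow> interval \<Rightarrow> interval tree" where
  "ST F i = (case find (\<lambda>t. i \<in> set_tree t) F of None \<Rightarrow> \<langle>\<rangle> | Some t \<Rightarrow> t)"

definition update :: "paths \<Rightarrow> interval \<Rightarrow> interval tree list \<Rightarrow> paths" where
  "update F i ts = filter (\<lambda>t. t \<noteq> \<langle>\<rangle>) ts @ filter (\<lambda>t. i \<notin> set_tree t) F"

definition find_ST :: "interval \<Rightarrow> interval \<Rightarrow> paths \<Rightarrow> bool \<times> paths \<times> nat" where
  "find_ST m i F =
    (let t = splay (finish m) (ST F m);
         t' = splay (finish i) t
     in (root_of t' = Some i, update F m [t'],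
         T_splay (finish m) (ST F m) + T_splay (finish i) t))"

definition max_ST :: "interval \<Rightarrow> paths \<Rightarrow> interval \<times> paths \<times> nat" where
  "max_ST i F =
    (let t = splay (finish i) (ST F i);
         t' = splay_max t
     in (value t', update F i [t'], T_splay (finish i) (ST F i) + T_splay_max t))"

definition pred_ST :: "interval \<Rightarrow> paths \<Rightarrow> interval option \<times> paths \<times> nat" where
  "pred_ST i F =
    (case splay (finish i) (ST F i) of \<langle>l, a, r\<rangle> \<Rightarrow>
       (root_of (splay_max l), update F i [\<langle>splay_max l, a, r\<rangle>],
        T_splay (finish i) (ST F i) + T_splay_max l))"

text \<open>Afterwards \<open>L(i)\<close> and \<open>R(i)\<close> are separate trees, and \<open>R(i)\<close> is the new \<open>ST\<^sub>i\<close>.\<close>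

definition split_ST :: "interval \<Rightarrow> paths \<Rightarrow> paths \<times> nat" where
  "split_ST i F =
    (case splay (finish i) (ST F i) of \<langle>l, a, r\<rangle> \<Rightarrow>
       (update F i [l, \<langle>\<langle>\<rangle>, a, r\<rangle>], T_splay (finish i) (ST F i)))"

definition join_ST :: "interval \<Rightarrow> interval \<Rightarrow> paths \<Rightarrow> paths \<times> nat" where
  "join_ST i i' F =
    (let t = splay (finish i) (ST F i);
         t' = splay (finish i') (ST F i')
     in (case splay_max t of \<langle>l, a, _\<rangle> \<Rightarrow>
           (update (update F i []) i' [\<langle>l, a, t'\<rangle>],
            T_splay (finish i) (ST F i) + T_splay (finish i') (ST F i') + T_splay_max t)))"

text \<open>
  Deleting \<open>i\<close> from its solid path deletes the two solid edges at \<open>i\<close>, so the part before \<open>i\<close> and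
  the part after \<open>i\<close> become separate paths. They must not be joined: if \<open>p\<close> precedes and \<open>s\<close>
  follows \<open>i\<close> on the path, then after the removal of \<open>i\<close> the parent of \<open>p\<close> is the interval next
  to \<open>i\<close>, which need not be \<open>s\<close>.
\<close>

definition delete_ST :: "interval \<Rightarrow> paths \<Rightarrow> paths \<times> nat" where
  "delete_ST i F =
    ((case splay (finish i) (ST F i) of
        \<langle>\<rangle> \<Rightarrow> F
      | \<langle>l, a, r\<rangle> \<Rightarrow> update F i [l, r]),
     T_splay (finish i) (ST F i))"


section \<open>The data structure \<open>MonCF\<close>\<close>

text \<open>The result \<open>None\<close> stands for non-termination of the loop.\<close>

definition expose :: "interval \<Rightarrow> avl \<Rightarrow> paths \<Rightarrow> (paths \<times> nat) option" where
  "expose i T F =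
    (let (j, F0, c0) = max_ST i F
     in map_option (\<lambda>(i', F, c). (F, c))
          (while_option
            (\<lambda>(i', F, c). i' \<noteq> None)
            (\<lambda>(i', F, c).
               let (F1, c1) = split_ST (the i') F;
                   (F2, c2) = join_ST i (the i') F1;
                   (j, F3, c3) = max_ST (the i') F2
               in (right_compatible j T, F3, c + c1 + c2 + c3 + T_right_compatible j T))
            (right_compatible j T, F0, c0 + T_right_compatible j T)))"

type_synonym moncf = "avl \<times> paths"

definition expose_min :: "avl \<Rightarrow> paths \<Rightarrow> (moncf \<times> nat) option" where
  "expose_min T F =
    (case tree_min T of
       None \<Rightarrow> Some ((T, F), T_tree_min T)
     | Some m \<Rightarrow> map_option (\<lambda>(F', c). ((T, F'), T_tree_min T + c)) (expose m T F))"

definition queryMonCF :: "interval \<Rightarrow> moncf \<Rightarrow> bool \<times> moncf \<times> nat" where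
  "queryMonCF i = (\<lambda>(T, F).
    (case tree_min T of
       None \<Rightarrow> (False, (T, F), T_tree_min T)
     | Some m \<Rightarrow> (let (b, F', c) = find_ST m i F in (b, (T, F'), T_tree_min T + c))))"

definition insertMonCF :: "interval \<Rightarrow> moncf \<Rightarrow> (moncf \<times> nat) option" where
  "insertMonCF i = (\<lambda>(T, F).
    (let T' = avl_insert i T;
         F0 = (if ST F i = \<langle>\<rangle> then \<langle>\<langle>\<rangle>, i, \<langle>\<rangle>\<rangle> # F else F);
         (F1, c1) =
           (case next_interval i T' of
              None \<Rightarrow> (F0, 0)
            | Some r \<Rightarrow>
                (let (p, F', c) = pred_ST r F0
                 in (case p of
                       None \<Rightarrow> (F', c)
                     | Some j \<Rightarrow>
                         if compatible j i
                         then (let (F'', c') = split_ST r F' in (F'', c + c'))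
                         else (F', c))))
     in map_option
          (\<lambda>(s, c). (s, T_avl_insert i T + T_next_interval i T' + c1 + c))
          (expose_min T' F1)))"

definition removeMonCF :: "interval \<Rightarrow> moncf \<Rightarrow> (moncf \<times> nat) option" where
  "removeMonCF i = (\<lambda>(T, F).
    (let (F', c') = delete_ST i F
     in map_option (\<lambda>(s, c). (s, c' + T_avl_delete i T + c))
          (expose_min (avl_delete i T) F')))"

text \<open>Executing an operation yields the answer (only for queries), the new state and the
  running time.\<close>

fun exec :: "operation \<Rightarrow> moncf \<Rightarrow> (bool option \<times> moncf \<times> nat) option" where
  "exec (Insert i) s = map_option (\<lambda>(s', c). (None, s', c)) (insertMonCF i s)"
| "exec (Remove i) s = map_option (\<lambda>(s', c). (None, s', c)) (removeMonCF i s)"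
| "exec (Query i) s = (let (b, s', c) = queryMonCF i s in Some (Some b, s', c))"

text \<open>\<open>run ops s\<close> lists the answers and running times of the operations \<open>ops\<close> executed in
  this order from state \<open>s\<close>.\<close>

fun run :: "operation list \<Rightarrow> moncf \<Rightarrow> (bool option \<times> nat) list option" where
  "run [] s = Some []"
| "run (x # xs) s =
    (case exec x s of
       None \<Rightarrow> None
     | Some (b, s', c) \<Rightarrow> map_option (\<lambda>tr. (b, c) # tr) (run xs s'))"

definition emptyMonCF :: moncf where
  "emptyMonCF = (\<langle>\<rangle>, [])"

fun charge ::
  "(nat \<Rightarrow> real) \<Rightarrow> (nat \<Rightarrow> real) \<Rightarrow> (nat \<Rightarrow> real) \<Rightarrow> operation \<Rightarrow> nat \<Rightarrow> real"
where
  "charge t_ins t_rem t_qry (Insert i) n = t_ins n"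
| "charge t_ins t_rem t_qry (Remove i) n = t_rem n"
| "charge t_ins t_rem t_qry (Query i) n = t_qry n"

end

theory Submission
  imports Defs
begin

text \<open>
  The greedy set consists of the nodes on the way from the least interval to its root in the
  compatibility forest, and \<open>expose\<close> makes exactly these nodes a solid path. As all splay and search
  trees have logarithmic (amortised) cost, it remains to bound the number of iterations of
  \<open>expose\<close> by an amortised \<open>O(log n)\<close>.

  Let \<open>w x\<close> be the number of descendants of \<open>x\<close>, and let the potential be \<open>n\<close> minus the sum of
  \<open>w x / w p\<close> over the solid edges from \<open>x\<close> to \<open>p\<close>. Ratios of siblings add up to at most 1. If an
  iteration replaces a solid child of \<open>p\<close> by \<open>x\<close>, and \<open>u = w x / w p\<close>, then 1 plus the change of
  the potential is at most \<open>2 (1 - u) \<le> 2 (ln (w p) - ln (w x))\<close>, which telescopes along the exposed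
  path to at most \<open>2 ln n\<close>.

  Inserting or removing \<open>i\<close> changes many parents (those of the children of \<open>i\<close>), but it changes
  \<open>w\<close> only on the two paths to the root from \<open>i\<close> and from the interval next to \<open>i\<close>. If \<open>c\<close> is the child
  of \<open>p\<close> on such a path, then the ratio at the solid child of \<open>p\<close>, whichever child this is, changes by
  at most \<open>ln (w p) - ln (w c)\<close>, taken before plus after the update; this again telescopes.
\<close>

section \<open>The compatibility forest of a monotonic set\<close>

text \<open>The ratio is a continuous substitute for the heavy/light classification of edges known
  from link-cut trees: the inequality \<open>1 - u \<le> - ln u\<close> takes the place of counting
  light edges on a path to the root, and comparing two forests becomes comparing two sums over one
  set of edges.

  Dashed edges are never stored, so a mass change of parents is free as long as it spares the solid
  edges. An insertion breaks only edges into the interval next to the new one, and at most one of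
  these is solid; hence a single split repairs the partition. A removal is read as an insertion
  backwards. In both cases the surviving solid edges belong to the forests before and after the
  update.

  The deficit \<open>card I - solidity I F\<close> is scaled by \<open>28 * lg (card I)\<close>
  because each iteration of the loop itself has logarithmic cost; this is the origin of the second
  logarithm. The scale moves with the size of the set, but as the deficit never exceeds that size,
  one insertion raises the potential through the scale by a constant only
  (\<open>lg_Suc\<close>).\<close>

definition good :: "interval set \<Rightarrow> bool" where
  "good I \<longleftrightarrow> finite I \<and> interval_set I \<and> monotonic I"

lemma good_finite: "good I \<Longrightarrow> finite I"
  by (simp add: good_def)

lemma good_start_finish: "good I \<Longrightarrow> x \<in> I \<Longrightarrow> start x < finish x"
  by (simp add: good_def interval_set_def)

lemma good_finish_eq: "good I \<Longrightarrow> x \<in> I \<Longrightarrow> y \<in> I \<Longrightarrow> finish x = finish y \<Longrightarrow> x = y"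
  by (auto simp: good_def interval_set_def inj_on_def)

lemma good_subset: "good J \<Longrightarrow> I \<subseteq> J \<Longrightarrow> good I"
  unfolding good_def interval_set_def monotonic_def
  by (elim conjE, intro conjI) (rule finite_subset, assumption+, blast, rule inj_on_subset, assumption+, blast)

text \<open>Otherwise the interval that finishes first would be properly contained in the other one.
  This is why a tree ordered by starting times can be searched for conditions stated in terms of
  \<open>\<prec>\<close>.\<close>

lemma good_start_less_iff:
  assumes "good I" "x \<in> I" "y \<in> I"
  shows "start x < start y \<longleftrightarrow> finish x < finish y"
proof -
  have *: "start a < start b" if "a \<in> I" "b \<in> I" "finish a < finish b" for a b
  proof (rule ccontr)
    assume "\<not> start a < start b"
    with that have "{start a..finish a} \<subseteq> {start b..finish b}"
      by auto
    moreover have "finish b \<in> {start b..finish b}" "finish b \<notin> {start a..finish a}"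
      using that good_start_finish[OF assms(1) that(2)] by auto
    ultimately show False
      using assms(1) that unfolding good_def monotonic_def by blast
  qed
  show ?thesis
    using *[of x y] *[of y x] good_finish_eq[OF assms] assms by force
qed

lemma good_start_eq:
  "good I \<Longrightarrow> x \<in> I \<Longrightarrow> y \<in> I \<Longrightarrow> start x = start y \<Longrightarrow> x = y"
  by (metis good_finish_eq good_start_less_iff less_irrefl linorder_neqE)

lemma prec_compatible_iff:
  "start i < finish i \<Longrightarrow> start j < finish j \<Longrightarrow> i \<prec> j \<and> compatible i j \<longleftrightarrow> finish i < start j"
  by (auto simp: prec_def compatible_def)

definition edge :: "interval set \<Rightarrow> interval \<Rightarrow> interval \<Rightarrow> bool" where
  "edge I x y \<longleftrightarrow> x \<in> I \<and> is_rc I x y"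

lemma edge_iff:
  assumes "good I"
  shows "edge I x y \<longleftrightarrow>
    x \<in> I \<and> y \<in> I \<and> finish x < start y \<and> (\<forall>k\<in>I. finish x < start k \<longrightarrow> finish y \<le> finish k)"
proof (cases "x \<in> I")
  case True
  then have *: "k \<in> I \<and> x \<prec> k \<and> compatible x k \<longleftrightarrow> k \<in> I \<and> finish x < start k" for k
    using good_start_finish[OF assms, of x] good_start_finish[OF assms, of k]
      prec_compatible_iff[of x k] by blast
  show ?thesis
    unfolding edge_def is_rc_def is_arg_min_def * not_less[symmetric] using True by blast
qed (simp add: edge_def)

lemma edge_less: "good I \<Longrightarrow> edge I x y \<Longrightarrow> finish x < finish y"
  using good_start_finish[of I y] by (force simp: edge_iff)

lemma edge_det: "good I \<Longrightarrow> edge I x y \<Longrightarrow> edge I x z \<Longrightarrow> y = z"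
  by (rule good_finish_eq[of I]) (simp_all add: edge_iff order.eq_iff)

lemma edge_mem: "good I \<Longrightarrow> edge I x y \<Longrightarrow> x \<in> I \<and> y \<in> I"
  by (simp add: edge_iff)

lemma edges_less: "(edge I)\<^sup>*\<^sup>* x y \<Longrightarrow> good I \<Longrightarrow> finish x \<le> finish y"
proof (induction rule: rtranclp_induct)
  case (step y z)
  then show ?case using edge_less[of I y z] by simp
qed simp

lemma edges_mem: "good I \<Longrightarrow> (edge I)\<^sup>*\<^sup>* x y \<Longrightarrow> y \<in> I \<Longrightarrow> x \<in> I"
  by (erule converse_rtranclpE) (simp, simp add: edge_mem)

text \<open>Induction from the roots downwards. It is well-founded because a parent finishes
  strictly later and therefore has fewer intervals after it.\<close>

lemma edge_induct [consumes 2, case_names step]: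
  assumes "good I" "x \<in> I"
    and "\<And>x. x \<in> I \<Longrightarrow> (\<And>y. edge I x y \<Longrightarrow> P y) \<Longrightarrow> P x"
  shows "P x"
  using assms(2)
proof (induction "card {y \<in> I. finish x < finish y}" arbitrary: x rule: less_induct)
  case less
  show ?case
  proof (rule assms(3)[OF less.prems])
    fix y assume e: "edge I x y"
    have "{z \<in> I. finish y < finish z} \<subset> {z \<in> I. finish x < finish z}"
      using edge_less[OF assms(1) e] edge_mem[OF assms(1) e] by auto
    then have "card {z \<in> I. finish y < finish z} < card {z \<in> I. finish x < finish z}"
      using good_finite[OF assms(1)] by (intro psubset_card_mono) auto
    then show "P y"
      using less.hyps edge_mem[OF assms(1) e] by blast
  qed
qed

section \<open>Subtree weights and the ratios of edges\<close>

definition weight :: "interval set \<Rightarrow> interval \<Rightarrow> real" where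
  "weight I x = card {y. (edge I)\<^sup>*\<^sup>* y x}"

definition ratio :: "interval set \<Rightarrow> interval \<times> interval \<Rightarrow> real" where
  "ratio I = (\<lambda>(x, p). weight I x / weight I p)"

lemma desc_subset: "good I \<Longrightarrow> x \<in> I \<Longrightarrow> {y. (edge I)\<^sup>*\<^sup>* y x} \<subseteq> I"
  using edges_mem by blast

lemma finite_desc: "good I \<Longrightarrow> x \<in> I \<Longrightarrow> finite {y. (edge I)\<^sup>*\<^sup>* y x}"
  by (rule finite_subset[OF desc_subset good_finite])

text \<open>The closure in \<open>weight\<close> is reflexive, so a node counts itself. This makes
  quotients of weights meaningful and their logarithms nonnegative.\<close>

lemma weight_ge_1: "good I \<Longrightarrow> x \<in> I \<Longrightarrow> 1 \<le> weight I x"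
proof -
  assume "good I" "x \<in> I"
  then have "card {y. (edge I)\<^sup>*\<^sup>* y x} \<noteq> 0"
    using finite_desc[of I x] unfolding card_eq_0_iff by blast
  then show ?thesis
    unfolding weight_def by linarith
qed

lemma weight_le_card: "good I \<Longrightarrow> x \<in> I \<Longrightarrow> weight I x \<le> card I"
  unfolding weight_def using desc_subset[of I x] good_finite[of I] by (simp add: card_mono)

text \<open>Parents are unique, so the ancestors of a common descendant form a chain and one sibling
  would lie above the other. Then \<open>p\<close> would lie below its own child, contradicting that
  finishing times grow along edges.\<close>

lemma siblings_disjoint:
  assumes "good I" "edge I x p" "edge I y p" "x \<noteq> y"
  shows "{z. (edge I)\<^sup>*\<^sup>* z x} \<inter> {z. (edge I)\<^sup>*\<^sup>* z y} = {}"
proof -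
  have conf: "(edge I)\<^sup>*\<^sup>* a b \<or> (edge I)\<^sup>*\<^sup>* b a" if "(edge I)\<^sup>*\<^sup>* z a" "(edge I)\<^sup>*\<^sup>* z b" for z a b
    using that
  proof (induction rule: converse_rtranclp_induct)
    case (step z w)
    from step.prems show ?case
    proof (cases rule: converse_rtranclpE)
      case base
      then show ?thesis using step.hyps by (meson converse_rtranclp_into_rtranclp)
    next
      case (step v)
      then show ?thesis using \<open>edge I z w\<close> edge_det[OF assms(1)] step.IH by blast
    qed
  qed simp
  have no: False if "(edge I)\<^sup>*\<^sup>* a b" "edge I a p" "edge I b p" "a \<noteq> b" for a b
  proof -
    from that(1,4) obtain c where "edge I a c" "(edge I)\<^sup>*\<^sup>* c b"
      by (metis converse_rtranclpE)
    then have "(edge I)\<^sup>*\<^sup>* p b"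
      using that(2) edge_det[OF assms(1)] by blast
    then show False
      using edges_less[OF _ assms(1), of p b] edge_less[OF assms(1) that(3)] by simp
  qed
  show ?thesis
  proof (rule equals0I)
    fix z assume "z \<in> {z. (edge I)\<^sup>*\<^sup>* z x} \<inter> {z. (edge I)\<^sup>*\<^sup>* z y}"
    then have "(edge I)\<^sup>*\<^sup>* x y \<or> (edge I)\<^sup>*\<^sup>* y x"
      using conf by blast
    then show False
      using no[OF _ assms(2,3,4)] no[OF _ assms(3,2)] assms(4) by blast
  qed
qed

lemma sibling_weights:
  assumes "good I" "edge I x p" "edge I y p" "x \<noteq> y"
  shows "weight I x + weight I y \<le> weight I p"
proof -
  have fin: "finite {z. (edge I)\<^sup>*\<^sup>* z a}" if "a \<in> {x, y, p}" for a
    using that assms edge_mem finite_desc by blast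
  have "card ({z. (edge I)\<^sup>*\<^sup>* z x} \<union> {z. (edge I)\<^sup>*\<^sup>* z y}) \<le> card {z. (edge I)\<^sup>*\<^sup>* z p}"
    using assms(2,3) by (intro card_mono fin) auto
  then show ?thesis
    using card_Un_disjoint[OF fin fin siblings_disjoint[OF assms]] by (simp add: weight_def)
qed

lemma weight_mono:
  assumes "good I" "edge I x p"
  shows "weight I x \<le> weight I p"
  unfolding weight_def using assms edge_mem[OF assms] finite_desc[OF assms(1), of p]
  by (auto intro!: card_mono)

lemma ratio_bounds:
  assumes "good I" "edge I x p"
  shows "0 < ratio I (x, p)" "ratio I (x, p) \<le> 1"
proof -
  have "1 \<le> weight I x" "1 \<le> weight I p"
    using weight_ge_1[OF assms(1)] edge_mem[OF assms] by blast+
  then show "0 < ratio I (x, p)" "ratio I (x, p) \<le> 1"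
    using weight_mono[OF assms] by (simp_all add: ratio_def)
qed

lemma sibling_ratios:
  assumes "good I" "edge I x p" "edge I y p" "x \<noteq> y"
  shows "ratio I (x, p) + ratio I (y, p) \<le> 1"
  using weight_ge_1[of I p] edge_mem[OF assms(1,2)] sibling_weights[OF assms] assms(1)
  by (simp add: ratio_def flip: add_divide_distrib)

lemma one_minus_ratio_le:
  assumes "good I" "edge I x p"
  shows "1 - ratio I (x, p) \<le> ln (weight I p) - ln (weight I x)"
proof -
  have "weight I x \<ge> 1" "weight I p \<ge> 1"
    using weight_ge_1[OF assms(1)] edge_mem[OF assms] by auto
  then have "ln (ratio I (x, p)) = ln (weight I x) - ln (weight I p)"
    by (simp add: ratio_def ln_div)
  moreover have "ln (ratio I (x, p)) \<le> ratio I (x, p) - 1"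
    using ratio_bounds[OF assms] ln_le_minus_one by blast
  ultimately show ?thesis by linarith
qed

subsection \<open>Adding one interval\<close>

definition is_next :: "interval set \<Rightarrow> interval \<Rightarrow> interval \<Rightarrow> bool" where
  "is_next I i r \<longleftrightarrow> r \<in> I \<and> i \<prec> r \<and> (\<forall>k\<in>I. i \<prec> k \<longrightarrow> finish r \<le> finish k)"

lemma is_next_unique: "good I \<Longrightarrow> is_next I i r \<Longrightarrow> is_next I i r' \<Longrightarrow> r = r'"
  by (rule good_finish_eq[of I]) (simp_all add: is_next_def order.eq_iff)

lemma sum_Un_le:
  fixes g :: "'a \<Rightarrow> real"
  assumes "finite A" "finite B" "\<And>x. 0 \<le> g x"
  shows "sum g (A \<union> B) \<le> sum g A + sum g B"
  using assms sum_Un[of A B g] sum_nonneg[of "A \<inter> B" g] by simp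

text \<open>Injectivity of \<open>snd\<close> on \<open>E\<close> means that at most one solid edge
  enters \<open>p\<close>, so the sum has one term or none; \<open>0 \<le> B\<close> serves the
  second case.\<close>

lemma sum_at_most_one:
  fixes g :: "'a \<times> 'b \<Rightarrow> real"
  assumes "inj_on snd E" "\<And>e. e \<in> E \<Longrightarrow> snd e = p \<Longrightarrow> g e \<le> B" "0 \<le> B"
  shows "sum g {e \<in> E. snd e = p} \<le> B"
proof (cases "\<exists>e\<in>E. snd e = p")
  case True
  then obtain e where "e \<in> E" "snd e = p" by blast
  then have "{e \<in> E. snd e = p} = {e}"
    using assms(1) by (auto simp: inj_on_def)
  then show ?thesis
    using assms(2) \<open>e \<in> E\<close> \<open>snd e = p\<close> by simp
next
  case False
  then have "{e \<in> E. snd e = p} = {}" by blast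
  then show ?thesis using assms(3) by (simp only: sum.empty)
qed

text \<open>Removal uses the same locale, with \<open>I\<close> standing for the set that remains,
  so only one direction of the update has to be analysed.\<close>

locale insertion =
  fixes I :: "interval set" and i :: interval
  assumes good': "good (insert i I)" and new: "i \<notin> I"
begin

abbreviation "J \<equiv> insert i I"

lemma good_I: "good I"
  using good' good_subset by blast

lemma edge_J_imp_I: "edge J x y \<Longrightarrow> x \<noteq> i \<Longrightarrow> y \<noteq> i \<Longrightarrow> edge I x y"
  by (auto simp: edge_iff[OF good'] edge_iff[OF good_I])

text \<open>An edge can be lost only because \<open>i\<close> takes over as the parent. Then
  \<open>i\<close> starts after \<open>x\<close> ends, hence so does everything after
  \<open>i\<close>, and the old parent, being least, is the interval right after \<open>i\<close>.
  All broken edges thus share one target.\<close>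

lemma edge_I_cases:
  assumes "edge I x y" "\<not> edge J x y"
  shows "edge J x i" "is_next I i y" "finish x < start i"
proof -
  have *: "x \<in> I" "y \<in> I" "finish x < start y" "\<forall>k\<in>I. finish x < start k \<longrightarrow> finish y \<le> finish k"
    using assms(1) by (auto simp: edge_iff[OF good_I])
  then have i: "finish x < start i" "finish i < finish y"
    using assms(2) by (auto simp: edge_iff[OF good'])
  then show "edge J x i" "finish x < start i"
    using * by (force simp: edge_iff[OF good'])+
  have "finish y \<le> finish k" if "k \<in> I" "i \<prec> k" for k
  proof -
    have "start i < start k"
      using that good_start_less_iff[OF good', of i k] by (auto simp: prec_def)
    then show ?thesis
      using * i that by auto
  qed
  then show "is_next I i y"
    using * i by (auto simp: is_next_def prec_def)
qed

lemma edge_after: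
  assumes "x \<in> I" "finish i < finish x"
  shows "edge I x y \<longleftrightarrow> edge J x y"
proof
  assume "edge I x y"
  then show "edge J x y"
    using edge_I_cases[of x y] assms good_start_finish[OF good', of i] by auto
next
  assume e: "edge J x y"
  then have "y \<noteq> i"
    using assms good_start_finish[OF good', of i] by (auto simp: edge_iff[OF good'])
  then show "edge I x y"
    using edge_J_imp_I[OF e] assms new by blast
qed

text \<open>The two chains on which weights may change: the one from the interval next to
  \<open>i\<close> can lose descendants to \<open>i\<close>, the one from the parent of
  \<open>i\<close> can gain them. Ancestors are taken in \<open>I\<close>; beyond \<open>i\<close>
  both forests have the same edges.\<close>

definition affected :: "interval \<Rightarrow> bool" where
  "affected p \<longleftrightarrow> (\<exists>c. (is_next I i c \<or> edge J i c) \<and> (edge I)\<^sup>*\<^sup>* c p)"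

lemma edges_after:
  assumes "(edge J)\<^sup>*\<^sup>* x y" "x \<in> I" "finish i < finish x"
  shows "(edge I)\<^sup>*\<^sup>* x y"
  using assms
proof (induction rule: converse_rtranclp_induct)
  case (step x z)
  then show ?case
    using edge_after[of x z] edge_less[OF good_I, of x z] edge_mem[OF good_I, of x z]
    by (auto intro: converse_rtranclp_into_rtranclp)
qed simp

text \<open>Both forests agree below \<open>p\<close>. In \<open>J\<close>, the node
  \<open>i\<close> is not below \<open>p\<close>, so every edge there already existed; in
  \<open>I\<close>, a broken edge below \<open>p\<close> would enter the interval next to
  \<open>i\<close> and make \<open>p\<close> affected.\<close>

lemma unaffected_weight:
  assumes "p \<in> I" "\<not> affected p"
  shows "weight I p = weight J p"
proof -
  have not_i: "\<not> (edge J)\<^sup>*\<^sup>* i p"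
  proof
    assume "(edge J)\<^sup>*\<^sup>* i p"
    then obtain c where c: "edge J i c" "(edge J)\<^sup>*\<^sup>* c p"
      using assms(1) new by (metis converse_rtranclpE)
    then have "finish i < finish c" "c \<in> I"
      using edge_less[OF good'] edge_mem[OF good'] by blast+
    then show False
      using edges_after[OF c(2)] c(1) assms(2) unfolding affected_def by blast
  qed
  have "(edge I)\<^sup>*\<^sup>* y p" if "(edge J)\<^sup>*\<^sup>* y p" for y
    using that
  proof (induction rule: converse_rtranclp_induct)
    case (step y z)
    have "y \<noteq> i" "z \<noteq> i"
      using step not_i by (auto intro: converse_rtranclp_into_rtranclp)
    then show ?case
      using edge_J_imp_I step by (meson converse_rtranclp_into_rtranclp)
  qed simp
  moreover have "(edge J)\<^sup>*\<^sup>* y p" if "(edge I)\<^sup>*\<^sup>* y p" for y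
    using that
  proof (induction rule: converse_rtranclp_induct)
    case (step y z)
    have "edge J y z"
      using edge_I_cases(2)[OF step.hyps(1)] assms(2) step.hyps(2) unfolding affected_def by blast
    then show ?case
      using step by (meson converse_rtranclp_into_rtranclp)
  qed simp
  ultimately have "{y. (edge I)\<^sup>*\<^sup>* y p} = {y. (edge J)\<^sup>*\<^sup>* y p}"
    by blast
  then show ?thesis
    by (simp add: weight_def)
qed

lemma unaffected_ratio:
  assumes "edge I x p" "edge J x p" "\<not> affected p"
  shows "ratio I (x, p) = ratio J (x, p)"
proof -
  have "\<not> affected x"
    using assms(1,3) unfolding affected_def by (meson rtranclp.rtrancl_into_rtrancl)
  then show ?thesis
    using unaffected_weight assms edge_mem[OF good_I] by (auto simp: ratio_def)
qed

definition logw :: "interval \<Rightarrow> real" where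
  "logw x = ln (weight I x) + ln (weight J x)"

text \<open>The change of the ratio at a solid child \<open>x\<close> of \<open>p\<close> is charged to an arbitrary common child
  \<open>c\<close> of \<open>p\<close>: if \<open>x = c\<close>, both ratios are at least \<open>1\<close> minus the charge, and otherwise both are at
  most the charge.\<close>

lemma ratio_change:
  assumes "edge I x p" "edge J x p" "edge I c p" "edge J c p"
  shows "\<bar>ratio I (x, p) - ratio J (x, p)\<bar> \<le> logw p - logw c"
proof (cases "x = c")
  case True
  then show ?thesis
    using one_minus_ratio_le[OF good_I assms(3)] one_minus_ratio_le[OF good' assms(4)]
      ratio_bounds[OF good_I assms(3)] ratio_bounds[OF good' assms(4)]
    unfolding logw_def True by linarith
next
  case False
  then show ?thesis
    using one_minus_ratio_le[OF good_I assms(3)] one_minus_ratio_le[OF good' assms(4)]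
      ratio_bounds[OF good_I assms(3)] ratio_bounds[OF good' assms(4)]
      ratio_bounds[OF good_I assms(1)] ratio_bounds[OF good' assms(2)]
      sibling_ratios[OF good_I assms(1,3)] sibling_ratios[OF good' assms(2,4)]
    unfolding logw_def by linarith
qed

lemma logw_bounds:
  assumes "x \<in> I"
  shows "0 \<le> logw x" "logw x \<le> 2 * ln (card J)"
proof -
  have w: "1 \<le> weight I x" "1 \<le> weight J x" "weight I x \<le> card I" "weight J x \<le> card J"
    using assms weight_ge_1 weight_le_card good_I good' by blast+
  have "weight I x \<le> card J"
    using w(3) new good_finite[OF good_I] by simp
  then have "ln (weight I x) \<le> ln (card J)" "ln (weight J x) \<le> ln (card J)"
    using w by (auto intro!: ln_mono)
  then show "0 \<le> logw x" "logw x \<le> 2 * ln (card J)"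
    using w ln_ge_zero[of "weight I x"] ln_ge_zero[of "weight J x"] unfolding logw_def
    by linarith+
qed

text \<open>At each parent \<open>p\<close> of the chain, the one solid edge into \<open>p\<close>
  is charged to the chain edge from \<open>c\<close> to \<open>p\<close>, and the charges telescope.
  Starting after \<open>i\<close> ensures that the chain edges lie in both forests, as
  \<open>ratio_change\<close> requires.\<close>

lemma chain_change:
  assumes E: "finite E" "inj_on snd E" "\<And>x p. (x, p) \<in> E \<Longrightarrow> edge I x p \<and> edge J x p"
    and "c \<in> I" "finish i < finish c"
  shows "(\<Sum>e | e \<in> E \<and> (edge I)\<^sup>+\<^sup>+ c (snd e). \<bar>ratio I e - ratio J e\<bar>)
    \<le> 2 * ln (card J) - logw c"
  using good_I assms(4,5)
proof (induction rule: edge_induct)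
  case (step c)
  let ?g = "\<lambda>e. \<bar>ratio I e - ratio J e\<bar>"
  show ?case
  proof (cases "\<exists>p. edge I c p")
    case False
    then have "{e. e \<in> E \<and> (edge I)\<^sup>+\<^sup>+ c (snd e)} = {}"
      by (auto dest: tranclpD)
    then show ?thesis
      using logw_bounds[OF step.hyps] by (simp only: sum.empty)
  next
    case True
    then obtain p where p: "edge I c p" ..
    have "edge J c p"
      using p edge_after step.hyps step.prems by blast
    have "p \<in> I" "finish i < finish p"
      using edge_less[OF good_I p] edge_mem[OF good_I p] step.prems by auto
    have "(edge I)\<^sup>+\<^sup>+ c y \<Longrightarrow> y = p \<or> (edge I)\<^sup>+\<^sup>+ p y" for y
      using p edge_det[OF good_I] by (metis rtranclpD tranclpD)
    then have "sum ?g {e. e \<in> E \<and> (edge I)\<^sup>+\<^sup>+ c (snd e)}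
        \<le> sum ?g ({e \<in> E. snd e = p} \<union> {e. e \<in> E \<and> (edge I)\<^sup>+\<^sup>+ p (snd e)})"
      using E(1) by (intro sum_mono2) (simp, blast, simp)
    also have "\<dots> \<le> sum ?g {e \<in> E. snd e = p} + sum ?g {e. e \<in> E \<and> (edge I)\<^sup>+\<^sup>+ p (snd e)}"
      using E(1) by (simp add: sum_Un_le)
    \<comment> \<open>The bounds for the edge from \<open>c\<close> to \<open>p\<close> give
      \<open>0 \<le> logw p - logw c\<close>, which is needed when no solid edge enters
      \<open>p\<close>.\<close>
    also have "sum ?g {e \<in> E. snd e = p} \<le> logw p - logw c"
      using E(2,3) ratio_change[OF _ _ p \<open>edge J c p\<close>] one_minus_ratio_le[OF good_I p]
        one_minus_ratio_le[OF good' \<open>edge J c p\<close>] ratio_bounds[OF good_I p]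
        ratio_bounds[OF good' \<open>edge J c p\<close>]
      by (intro sum_at_most_one) (auto simp: logw_def)
    also have "sum ?g {e. e \<in> E \<and> (edge I)\<^sup>+\<^sup>+ p (snd e)} \<le> 2 * ln (card J) - logw p"
      using step.IH[OF p] \<open>finish i < finish p\<close> by blast
    finally show ?thesis by simp
  qed
qed

text \<open>Each of the two chains contributes \<open>1 + 2 * ln (card J)\<close>. The 1 is for the
  solid edge into the first node of the chain, which has no common child to be charged to, but whose
  ratio stays between 0 and 1.\<close>

lemma total_change:
  assumes E: "finite E" "inj_on snd E" "\<And>x p. (x, p) \<in> E \<Longrightarrow> edge I x p \<and> edge J x p"
  shows "\<bar>sum (ratio I) E - sum (ratio J) E\<bar> \<le> 2 + 4 * ln (card J)"
proof -
  let ?g = "\<lambda>e. \<bar>ratio I e - ratio J e\<bar>"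
  define D where "D P = {e \<in> E. \<exists>c. P c \<and> (edge I)\<^sup>*\<^sup>* c (snd e)}" for P
  have bound: "sum ?g (D P) \<le> 1 + 2 * ln (card J)"
    if P: "\<And>c. P c \<Longrightarrow> c \<in> I \<and> finish i < finish c" "\<And>c d. P c \<Longrightarrow> P d \<Longrightarrow> c = d" for P
  proof (cases "\<exists>c. P c")
    case False
    then have "D P = {}" by (simp add: D_def)
    moreover have "1 \<le> real (card J)"
      using good_finite[OF good_I] new by simp
    ultimately show ?thesis by simp
  next
    case True
    then obtain c where c: "P c" ..
    have "D P = {e \<in> E. (edge I)\<^sup>*\<^sup>* c (snd e)}"
      unfolding D_def using c P(2) by blast
    also have "\<dots> = {e \<in> E. snd e = c} \<union> {e. e \<in> E \<and> (edge I)\<^sup>+\<^sup>+ c (snd e)}"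
      unfolding Nitpick.rtranclp_unfold by blast
    finally have "D P = \<dots>" .
    then have "sum ?g (D P) \<le> sum ?g {e \<in> E. snd e = c} + sum ?g {e. e \<in> E \<and> (edge I)\<^sup>+\<^sup>+ c (snd e)}"
      using E(1) by (simp add: sum_Un_le)
    also have "sum ?g {e \<in> E. snd e = c} \<le> 1"
    proof (intro sum_at_most_one E(2))
      fix e assume "e \<in> E"
      then have "edge I (fst e) (snd e)" "edge J (fst e) (snd e)"
        using E(3) by auto
      then show "?g e \<le> 1"
        using ratio_bounds[OF good_I, of "fst e" "snd e"] ratio_bounds[OF good', of "fst e" "snd e"]
        by simp
    qed simp
    also have "sum ?g {e. e \<in> E \<and> (edge I)\<^sup>+\<^sup>+ c (snd e)} \<le> 2 * ln (card J)"
      using chain_change[OF E, of c] P(1)[OF c] logw_bounds[of c] by auto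
    finally show ?thesis by simp
  qed
  have "\<bar>sum (ratio I) E - sum (ratio J) E\<bar> \<le> sum ?g E"
    by (simp flip: sum_subtractf)
  also have "\<dots> = sum ?g (D (\<lambda>c. is_next I i c \<or> edge J i c))"
  proof (rule sum.mono_neutral_right[OF E(1)])
    show "\<forall>e\<in>E - D (\<lambda>c. is_next I i c \<or> edge J i c). ?g e = 0"
    proof
      fix e assume "e \<in> E - D (\<lambda>c. is_next I i c \<or> edge J i c)"
      then have "(fst e, snd e) \<in> E" "\<not> affected (snd e)"
        unfolding D_def affected_def by auto
      then show "?g e = 0"
        using unaffected_ratio[of "fst e" "snd e"] E(3) by simp
    qed
  qed (auto simp: D_def)
  also have "D (\<lambda>c. is_next I i c \<or> edge J i c) = D (is_next I i) \<union> D (edge J i)"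
    by (auto simp: D_def)
  also have "sum ?g \<dots> \<le> sum ?g (D (is_next I i)) + sum ?g (D (edge J i))"
    using E(1) by (simp add: sum_Un_le D_def)
  also have "sum ?g (D (is_next I i)) \<le> 1 + 2 * ln (card J)"
  proof (rule bound)
    show "c \<in> I \<and> finish i < finish c" if "is_next I i c" for c
      using that by (simp add: is_next_def prec_def)
  qed (rule is_next_unique[OF good_I])
  also have "sum ?g (D (edge J i)) \<le> 1 + 2 * ln (card J)"
  proof (rule bound)
    show "c \<in> I \<and> finish i < finish c" if "edge J i c" for c
      using edge_mem[OF good' that] edge_less[OF good' that] by auto
  qed (rule edge_det[OF good'])
  finally show ?thesis by simp
qed

end

section \<open>AVL trees\<close>

fun avl_ok :: "avl \<Rightarrow> bool" where
  "avl_ok \<langle>\<rangle> \<longleftrightarrow> True"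
| "avl_ok \<langle>l, (a, h), r\<rangle> \<longleftrightarrow> height l \<le> height r + 1 \<and> height r \<le> height l + 1 \<and>
     h = max (height l) (height r) + 1 \<and> avl_ok l \<and> avl_ok r"

lemma ht_eq_height: "avl_ok t \<Longrightarrow> ht t = height t"
  by (cases t) auto

lemma node_avl_ok:
  "avl_ok l \<Longrightarrow> avl_ok r \<Longrightarrow> height l \<le> height r + 1 \<Longrightarrow> height r \<le> height l + 1 \<Longrightarrow>
    avl_ok (node l a r) \<and> height (node l a r) = max (height l) (height r) + 1"
  by (simp add: node_def ht_eq_height)

lemma bal_left_heavy:
  assumes "avl_ok l" "avl_ok r" "height l = height r + 2"
  shows "avl_ok (bal l a r) \<and> height l \<le> height (bal l a r) \<and> height (bal l a r) \<le> height l + 1"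
proof -
  obtain ll b n lr where l: "l = \<langle>ll, (b, n), lr\<rangle>"
    using assms(3) by (cases l) auto
  have ok: "avl_ok ll" "avl_ok lr" "max (height ll) (height lr) = height r + 1"
    "height ll \<le> height lr + 1" "height lr \<le> height ll + 1"
    using assms l by auto
  show ?thesis
  proof (cases "height lr \<le> height ll")
    case True
    then have "bal l a r = node ll b (node lr a r)"
      using assms ok l by (simp add: bal_def ht_eq_height)
    then show ?thesis
      using node_avl_ok[of lr r a] node_avl_ok[of ll "node lr a r" b] ok True assms l
      by (auto simp: max_def split: if_splits)
  next
    case False
    then obtain x c k y where lr: "lr = \<langle>x, (c, k), y\<rangle>"
      by (cases lr) auto
    have "bal l a r = node (node ll b x) c (node y a r)"
      using assms ok l False by (simp add: bal_def ht_eq_height lr)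
    then show ?thesis
      using node_avl_ok[of ll x b] node_avl_ok[of y r a] node_avl_ok[of "node ll b x" "node y a r" c]
        ok False assms l lr
      by (auto simp: max_def split: if_splits)
  qed
qed

lemma bal_right_heavy:
  assumes "avl_ok l" "avl_ok r" "height r = height l + 2"
  shows "avl_ok (bal l a r) \<and> height r \<le> height (bal l a r) \<and> height (bal l a r) \<le> height r + 1"
proof -
  obtain rl b n rr where r: "r = \<langle>rl, (b, n), rr\<rangle>"
    using assms(3) by (cases r) auto
  have ok: "avl_ok rl" "avl_ok rr" "max (height rl) (height rr) = height l + 1"
    "height rl \<le> height rr + 1" "height rr \<le> height rl + 1"
    using assms r by auto
  show ?thesis
  proof (cases "height rl \<le> height rr")
    case True
    then have "bal l a r = node (node l a rl) b rr"
      using assms ok r by (simp add: bal_def ht_eq_height)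
    then show ?thesis
      using node_avl_ok[of l rl a] node_avl_ok[of "node l a rl" rr b] ok True assms r
      by (auto simp: max_def split: if_splits)
  next
    case False
    then obtain x c k y where rl: "rl = \<langle>x, (c, k), y\<rangle>"
      by (cases rl) auto
    have "bal l a r = node (node l a x) c (node y b rr)"
      using assms ok r False by (simp add: bal_def ht_eq_height rl)
    then show ?thesis
      using node_avl_ok[of l x a] node_avl_ok[of y rr b] node_avl_ok[of "node l a x" "node y b rr" c]
        ok False assms r rl
      by (auto simp: max_def split: if_splits)
  qed
qed

text \<open>A difference of 2 is the worst that arises when one subtree has grown or shrunk by one
  level. The height bounds let the inductions below conclude that the whole tree again changes by at
  most one level.\<close>

lemma bal_avl_ok:
  assumes "avl_ok l" "avl_ok r" "height l \<le> height r + 2" "height r \<le> height l + 2"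
  shows "avl_ok (bal l a r)"
    and "max (height l) (height r) \<le> height (bal l a r)"
    and "height (bal l a r) \<le> max (height l) (height r) + 1"
    and "height l \<le> height r + 1 \<Longrightarrow> height r \<le> height l + 1 \<Longrightarrow>
      height (bal l a r) = max (height l) (height r) + 1"
proof -
  have "avl_ok (bal l a r) \<and> max (height l) (height r) \<le> height (bal l a r) \<and>
      height (bal l a r) \<le> max (height l) (height r) + 1 \<and>
      (height l \<le> height r + 1 \<longrightarrow> height r \<le> height l + 1 \<longrightarrow>
        height (bal l a r) = max (height l) (height r) + 1)"
  proof -
    consider "height l = height r + 2" | "height r = height l + 2"
      | "height l \<le> height r + 1" "height r \<le> height l + 1"
      using assms(3,4) by linarith
    then show ?thesis
    proof cases
      case 3
      then have "bal l a r = node l a r"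
        using assms by (simp add: bal_def ht_eq_height)
      then show ?thesis
        using node_avl_ok[OF assms(1,2) 3] by (simp add: max_def)
    qed (use bal_left_heavy[OF assms(1,2)] bal_right_heavy[OF assms(1,2)] in simp_all)
  qed
  then show "avl_ok (bal l a r)" "max (height l) (height r) \<le> height (bal l a r)"
    "height (bal l a r) \<le> max (height l) (height r) + 1"
    "height l \<le> height r + 1 \<Longrightarrow> height r \<le> height l + 1 \<Longrightarrow>
      height (bal l a r) = max (height l) (height r) + 1"
    by blast+
qed

lemma avl_ok_insert:
  "avl_ok t \<Longrightarrow> avl_ok (avl_insert x t) \<and>
    (height (avl_insert x t) = height t \<or> height (avl_insert x t) = height t + 1)"
proof (induction x t rule: avl_insert.induct)
  case (2 x l a h r)
  show ?case
  proof (cases "start x < start a")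
    case True
    then show ?thesis
      using 2 bal_avl_ok[of "avl_insert x l" r a] by (auto simp: max_def split: if_splits)
  next
    case False
    then show ?thesis
      using 2 bal_avl_ok[of l "avl_insert x r" a] by (auto simp: max_def split: if_splits)
  qed
qed (simp add: node_def)

lemma avl_ok_split_max:
  "t \<noteq> \<langle>\<rangle> \<Longrightarrow> avl_ok t \<Longrightarrow> avl_split_max t = (t', m) \<Longrightarrow>
    avl_ok t' \<and> (height t = height t' \<or> height t = height t' + 1)"
proof (induction t arbitrary: t' m rule: avl_split_max.induct)
  case (1 l a h r)
  show ?case
  proof (cases "r = \<langle>\<rangle>")
    case False
    then obtain r' where r': "avl_split_max r = (r', m)" "t' = bal l a r'"
      using 1 by (auto split: prod.splits)
    then show ?thesis
      using 1 False bal_avl_ok[of l r' a] by (auto simp: max_def split: if_splits)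
  qed (use 1 in auto)
qed simp

lemma avl_ok_delete:
  "avl_ok t \<Longrightarrow> avl_ok (avl_delete x t) \<and>
    (height t = height (avl_delete x t) \<or> height t = height (avl_delete x t) + 1)"
proof (induction x t rule: avl_delete.induct)
  case (2 x l a h r)
  consider "start x < start a" | "start a < start x"
    | "x = a" "l = \<langle>\<rangle>" | "x = a" "l \<noteq> \<langle>\<rangle>" | "start x = start a" "x \<noteq> a"
    by fastforce
  then show ?case
  proof cases
    case 1
    then show ?thesis
      using 2 bal_avl_ok[of "avl_delete x l" r a] by (auto simp: max_def split: if_splits)
  next
    case 2
    then show ?thesis
      using "2.IH" "2.prems" bal_avl_ok[of l "avl_delete x r" a] by (auto simp: max_def split: if_splits)
  next
    case 4
    obtain l' m where "avl_split_max l = (l', m)"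
      by (cases "avl_split_max l")
    then show ?thesis
      using 4 "2.prems" avl_ok_split_max[of l l' m] bal_avl_ok[of l' r m] by (auto simp: max_def split: if_splits)
  qed (use "2.prems" in auto)
qed simp

text \<open>Squaring the size makes a cross term available that compensates for a subtree lower by
  one level, so no Fibonacci numbers are needed.\<close>

lemma avl_ok_height: "avl_ok t \<Longrightarrow> 2 ^ height t \<le> (size1 t)\<^sup>2"
proof (induction t rule: avl_ok.induct)
  case (2 l a h r)
  define x where "x = size1 l"
  define y where "y = size1 r"
  define k where "k = min (height l) (height r)"
  define A :: nat where "A = 2 ^ k"
  have IH: "2 ^ height l \<le> x\<^sup>2" "2 ^ height r \<le> y\<^sup>2"
    using 2 by (auto simp: x_def y_def)
  then have A: "A \<le> x\<^sup>2" "A \<le> y\<^sup>2"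
    unfolding A_def k_def
    by (meson dual_order.trans min.cobounded1 min.cobounded2 one_le_numeral power_increasing)+
  have "A\<^sup>2 \<le> (x * y)\<^sup>2"
    using mult_le_mono[OF A] by (simp add: power2_eq_square algebra_simps)
  then have xy: "A \<le> x * y"
    using power2_le_imp_le by blast
  have sq: "(x + y)\<^sup>2 = x\<^sup>2 + y\<^sup>2 + 2 * (x * y)"
    by (simp add: power2_eq_square algebra_simps)
  have "height l = k \<and> height r = k \<or> height l = Suc k \<and> height r = k \<or> height l = k \<and> height r = Suc k"
    using "2.prems" by (auto simp: k_def min_def)
  \<comment> \<open>For equal heights \<open>2 * A\<close> is required and the two squares provide
    it. For unequal heights \<open>4 * A\<close> is required, and the squares and the cross term
    provide at least \<open>2 * A\<close>, \<open>A\<close> and \<open>2 * A\<close>.\<close>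
  then have "2 ^ Suc (max (height l) (height r)) \<le> (x + y)\<^sup>2"
    using IH A xy sq by (auto simp: A_def)
  then show ?case
    by (simp add: x_def y_def)
qed simp

lemma avl_ok_log_height:
  assumes "avl_ok t"
  shows "height t \<le> 2 * log 2 (size1 t)"
proof -
  have "real (2 ^ height t) \<le> real ((size1 t)\<^sup>2)"
    using avl_ok_height[OF assms] of_nat_le_iff by blast
  then have "log 2 (2 ^ height t) \<le> log 2 ((real (size1 t))\<^sup>2)"
    by (intro log_mono) auto
  then show ?thesis
    by (simp add: log_nat_power)
qed

lemma T_avl_bounds:
  "T_avl_insert i t \<le> height t + 1" "T_avl_split_max t \<le> height t + 1"
  "T_avl_delete i t \<le> height t + 1" "T_tree_min t \<le> height t + 1"
  "T_next_interval i t \<le> height t + 1" "T_right_compatible i t \<le> height t + 1"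
proof -
  show split: "T_avl_split_max t \<le> height t + 1" for t
    by (induction t rule: T_avl_split_max.induct) auto
  show "T_avl_delete i t \<le> height t + 1"
  proof (induction i t rule: T_avl_delete.induct)
    case (2 i l a h r)
    then show ?case
      using split[of l] by auto
  qed simp
  show "T_avl_insert i t \<le> height t + 1"
    by (induction i t rule: T_avl_insert.induct) auto
  show "T_tree_min t \<le> height t + 1"
    by (induction t rule: T_tree_min.induct) auto
  show "T_next_interval i t \<le> height t + 1"
    by (induction i t rule: T_next_interval.induct) auto
  show "T_right_compatible i t \<le> height t + 1"
    by (induction i t rule: T_right_compatible.induct) auto
qed

section \<open>Contents and order of the search tree\<close>

definition keys :: "avl \<Rightarrow> interval list" where
  "keys t = map fst (inorder t)"

lemma keys_simps [simp]: "keys \<langle>\<rangle> = []" "keys \<langle>l, (a, h), r\<rangle> = keys l @ a # keys r"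
  by (simp_all add: keys_def)

lemma keys_Nil_iff [simp]: "keys t = [] \<longleftrightarrow> t = \<langle>\<rangle>"
  by (simp add: keys_def)

lemma keys_bal [simp]: "keys (bal l a r) = keys l @ a # keys r"
  by (auto simp: bal_def node_def split: tree.splits)

definition increasing :: "interval list \<Rightarrow> bool" where
  "increasing = sorted_wrt (\<lambda>x y. start x < start y)"

lemma increasing_simps [simp]:
  "increasing []"
  "increasing (x # xs) \<longleftrightarrow> (\<forall>y\<in>set xs. start x < start y) \<and> increasing xs"
  "increasing (xs @ ys) \<longleftrightarrow>
    increasing xs \<and> increasing ys \<and> (\<forall>x\<in>set xs. \<forall>y\<in>set ys. start x < start y)"
  unfolding increasing_def by (auto simp: sorted_wrt_append)

text \<open>\<open>avl_insert\<close> ignores an interval whose starting time is already present.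
  The hypothesis excludes this for a different interval; in a good set it holds by
  \<open>good_start_eq\<close>.\<close>

lemma keys_insert:
  "increasing (keys t) \<Longrightarrow> \<forall>y\<in>set (keys t). start y = start x \<longrightarrow> y = x \<Longrightarrow>
    increasing (keys (avl_insert x t)) \<and> set (keys (avl_insert x t)) = insert x (set (keys t))"
proof (induction x t rule: avl_insert.induct)
  case (2 x l a h r)
  consider "start x < start a" | "start a < start x" | "x = a"
    using 2 by force
  then show ?case
  proof cases
    case 1
    then have "increasing (keys (avl_insert x l)) \<and> set (keys (avl_insert x l)) = insert x (set (keys l))"
      using "2.IH"(1) "2.prems" by simp
    with 1 2 show ?thesis by auto
  next
    case 2
    then have "increasing (keys (avl_insert x r)) \<and> set (keys (avl_insert x r)) = insert x (set (keys r))"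
      using "2.IH"(2) "2.prems" by simp
    with 2 "2.prems" show ?thesis by auto
  qed (use "2.prems" in auto)
qed (simp add: node_def)

lemma keys_split_max:
  "t \<noteq> \<langle>\<rangle> \<Longrightarrow> avl_split_max t = (t', m) \<Longrightarrow> keys t = keys t' @ [m]"
  by (induction t arbitrary: t' m rule: avl_split_max.induct) (auto split: prod.splits if_splits)

lemma keys_delete:
  "increasing (keys t) \<Longrightarrow>
    increasing (keys (avl_delete x t)) \<and> set (keys (avl_delete x t)) = set (keys t) - {x}"
proof (induction x t rule: avl_delete.induct)
  case (2 x l a h r)
  consider "start x < start a" | "start a < start x"
    | "x = a" "l = \<langle>\<rangle>" | "x = a" "l \<noteq> \<langle>\<rangle>" | "start x = start a" "x \<noteq> a"
    by fastforce
  then show ?case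
  proof cases
    case 1
    then have "increasing (keys (avl_delete x l)) \<and> set (keys (avl_delete x l)) = set (keys l) - {x}"
      using "2.IH"(1) "2.prems" by simp
    with 1 2 show ?thesis by auto
  next
    case 2
    then have "increasing (keys (avl_delete x r)) \<and> set (keys (avl_delete x r)) = set (keys r) - {x}"
      using "2.IH"(2) "2.prems" by simp
    with 2 "2.prems" show ?thesis by auto
  next
    case 4
    obtain l' m where "avl_split_max l = (l', m)"
      by (cases "avl_split_max l")
    then show ?thesis
      using 4 "2.prems" keys_split_max[of l l' m] by auto
  qed (use "2.prems" in auto)
qed simp

section \<open>Searching for the first key with a given property\<close>

lemma find_append: "find P (xs @ ys) = (case find P xs of None \<Rightarrow> find P ys | Some x \<Rightarrow> Some x)"
  by (induction xs) auto

lemma find_none: "(\<And>x. x \<in> set xs \<Longrightarrow> \<not> P x) \<Longrightarrow> find P xs = None"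
  by (simp add: find_None_iff)

text \<open>Common form of the walks of \<open>right_compatible\<close> and
  \<open>next_interval\<close>, so that their correctness is proved once.\<close>

fun search :: "(interval \<Rightarrow> bool) \<Rightarrow> avl \<Rightarrow> interval option \<Rightarrow> interval option" where
  "search P \<langle>\<rangle> best = best"
| "search P \<langle>l, (j, h), r\<rangle> best = (if P j then search P l (Some j) else search P r best)"

lemma rc_from_eq_search: "rc_from i t = search (\<lambda>j. i \<prec> j \<and> compatible i j) t"
proof
  show "rc_from i t best = search (\<lambda>j. i \<prec> j \<and> compatible i j) t best" for best
    by (induction i t best rule: rc_from.induct) auto
qed

lemma next_from_eq_search: "next_from i t = search ((\<prec>) i) t"
proof
  show "next_from i t best = search ((\<prec>) i) t best" for best
    by (induction i t best rule: next_from.induct) auto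
qed

definition upward_closed :: "(interval \<Rightarrow> bool) \<Rightarrow> interval set \<Rightarrow> bool" where
  "upward_closed P A \<longleftrightarrow> (\<forall>x\<in>A. \<forall>y\<in>A. start x < start y \<longrightarrow> P x \<longrightarrow> P y)"

lemma upward_closed_subset: "upward_closed P A \<Longrightarrow> B \<subseteq> A \<Longrightarrow> upward_closed P B"
  unfolding upward_closed_def by blast

text \<open>If \<open>P\<close> fails at the root, upward closure makes it fail in the whole left
  subtree. If it holds there, the root is the first hit unless the left subtree has an earlier one,
  which is what recording it expresses.\<close>

lemma search_find:
  "increasing (keys t) \<Longrightarrow> upward_closed P (set (keys t)) \<Longrightarrow>
    search P t best = (case find P (keys t) of None \<Rightarrow> best | Some j \<Rightarrow> Some j)"
proof (induction P t best rule: search.induct)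
  case (2 P l j h r best)
  have up: "upward_closed P (set (keys l))" "upward_closed P (set (keys r))"
    by (rule upward_closed_subset[OF "2.prems"(2)]; auto)+
  show ?case
  proof (cases "P j")
    case True
    then show ?thesis
      using "2.IH"(1) "2.prems"(1) up by (simp add: find_append split: option.splits)
  next
    case False
    have "find P (keys l) = None"
    proof (rule find_none)
      fix x assume "x \<in> set (keys l)"
      then have "start x < start j" "x \<in> set (keys \<langle>l, (j, h), r\<rangle>)" "j \<in> set (keys \<langle>l, (j, h), r\<rangle>)"
        using "2.prems"(1) by auto
      then show "\<not> P x"
        using False "2.prems"(2) unfolding upward_closed_def by blast
    qed
    then show ?thesis
      using False "2.IH"(2) "2.prems"(1) up by (simp add: find_append)
  qed
qed simp

lemma find_increasing:
  "increasing xs \<Longrightarrow> find P xs = Some j \<longleftrightarrow>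
    j \<in> set xs \<and> P j \<and> (\<forall>k\<in>set xs. P k \<longrightarrow> start j \<le> start k)"
  by (induction xs) force+

lemma tree_min_keys: "tree_min t = (if t = \<langle>\<rangle> then None else Some (hd (keys t)))"
  by (induction t rule: tree_min.induct) auto

section \<open>Search trees that represent an interval set\<close>

definition tree_of :: "interval set \<Rightarrow> avl \<Rightarrow> bool" where
  "tree_of I t \<longleftrightarrow> avl_ok t \<and> increasing (keys t) \<and> set (keys t) = I"

lemma tree_of_empty: "tree_of {} \<langle>\<rangle>"
  by (simp add: tree_of_def)

lemma tree_of_insert: "tree_of I t \<Longrightarrow> good (insert i I) \<Longrightarrow> tree_of (insert i I) (avl_insert i t)"
  using good_start_eq[of "insert i I" _ i] keys_insert[of t i] avl_ok_insert[of t i]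
  unfolding tree_of_def by blast

lemma tree_of_delete: "tree_of I t \<Longrightarrow> tree_of (I - {i}) (avl_delete i t)"
  using keys_delete[of t i] avl_ok_delete[of t i] unfolding tree_of_def by blast

lemma size_tree_of:
  assumes "tree_of I t"
  shows "size t = card I"
proof -
  have "distinct (keys t)"
    using assms unfolding tree_of_def increasing_def
    by (auto simp: sorted_wrt_iff_nth_less distinct_conv_nth) (metis nat_neq_iff order_less_irrefl)
  then have "card I = length (keys t)"
    using assms distinct_card by (auto simp: tree_of_def)
  then show ?thesis
    by (simp add: keys_def)
qed

text \<open>For intervals after \<open>x\<close>, compatibility reduces to
  \<open>finish x < start k\<close>, a condition on starting times alone; it is therefore upward
  closed in the order of the tree.\<close>

lemma right_compatible_iff:
  assumes "tree_of I t" "good I" "x \<in> I"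
  shows "right_compatible x t = Some y \<longleftrightarrow> edge I x y"
proof -
  have t: "increasing (keys t)" "set (keys t) = I"
    using assms(1) by (auto simp: tree_of_def)
  have P: "x \<prec> k \<and> compatible x k \<longleftrightarrow> finish x < start k" if "k \<in> I" for k
    using prec_compatible_iff good_start_finish[OF assms(2)] assms(3) that by blast
  have "right_compatible x t = find (\<lambda>k. x \<prec> k \<and> compatible x k) (keys t)"
    unfolding right_compatible_def
      rc_from_eq_search
  proof (subst search_find[OF t(1)])
    show "upward_closed (\<lambda>k. x \<prec> k \<and> compatible x k) (set (keys t))"
      unfolding upward_closed_def t(2) using P by (meson order.strict_trans)
  qed (simp split: option.splits)
  also have "\<dots> = Some y \<longleftrightarrow> y \<in> I \<and> (x \<prec> y \<and> compatible x y) \<and>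
      (\<forall>k\<in>I. x \<prec> k \<and> compatible x k \<longrightarrow> start y \<le> start k)"
    using find_increasing[OF t(1)] t(2) by simp
  also have "\<dots> \<longleftrightarrow> y \<in> I \<and> finish x < start y \<and> (\<forall>k\<in>I. finish x < start k \<longrightarrow> finish y \<le> finish k)"
    using P good_start_less_iff[OF assms(2)] by (meson not_less)
  finally show ?thesis
    using edge_iff[OF assms(2)] assms(3) by simp
qed

lemma next_interval_iff:
  assumes "tree_of I t" "good I"
  shows "next_interval x t = Some y \<longleftrightarrow> is_next I x y"
proof -
  have t: "increasing (keys t)" "set (keys t) = I"
    using assms(1) by (auto simp: tree_of_def)
  have "next_interval x t = find (\<lambda>k. x \<prec> k) (keys t)"
    unfolding next_interval_def
      next_from_eq_search
  proof (subst search_find[OF t(1)])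
    show "upward_closed ((\<prec>) x) (set (keys t))"
      unfolding upward_closed_def t(2) prec_def
      using good_start_less_iff[OF assms(2)] by (meson order.strict_trans)
  qed (simp split: option.splits)
  also have "\<dots> = Some y \<longleftrightarrow> y \<in> I \<and> x \<prec> y \<and> (\<forall>k\<in>I. x \<prec> k \<longrightarrow> start y \<le> start k)"
    using find_increasing[OF t(1)] t(2) by simp
  also have "\<dots> \<longleftrightarrow> is_next I x y"
    unfolding is_next_def using good_start_less_iff[OF assms(2)] by (meson not_less)
  finally show ?thesis .
qed

lemma tree_min_cases:
  assumes "tree_of I t" "good I"
  obtains "tree_min t = None" "I = {}"
  | m where "tree_min t = Some m" "m \<in> I" "\<And>k. k \<in> I \<Longrightarrow> finish m \<le> finish k"
proof (cases "t = \<langle>\<rangle>")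
  case True
  then show ?thesis
    using assms that(1) by (simp add: tree_of_def)
next
  case False
  have t: "increasing (keys t)" "set (keys t) = I"
    using assms(1) by (auto simp: tree_of_def)
  from False obtain m ms where m: "keys t = m # ms"
    by (metis keys_Nil_iff neq_Nil_conv)
  show ?thesis
  proof (rule that(2))
    show "tree_min t = Some m"
      using m False by (simp add: tree_min_keys)
    show "m \<in> I"
      using m t by auto
    then show "finish m \<le> finish k" if "k \<in> I" for k
      using m t that good_start_less_iff[OF assms(2), of m k] by force
  qed
qed

section \<open>Splay trees\<close>

lemma splay_Leaf_iff [simp]: "splay k t = \<langle>\<rangle> \<longleftrightarrow> t = \<langle>\<rangle>"
  by (induction k t rule: splay.induct) (auto split: tree.splits)

lemma inorder_splay [simp]: "inorder (splay k t) = inorder t"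
  by (induction k t rule: splay.induct) (auto split: tree.splits)

lemma set_tree_splay [simp]: "set_tree (splay k t) = set_tree t"
  by (metis inorder_splay set_inorder)

lemma size1_splay [simp]: "size1 (splay k t) = size1 t"
  by (metis inorder_splay length_inorder size1_size)

lemma splay_max_Leaf_iff [simp]: "splay_max t = \<langle>\<rangle> \<longleftrightarrow> t = \<langle>\<rangle>"
  by (induction t rule: splay_max.induct) (auto split: tree.splits)

lemma inorder_splay_max [simp]: "inorder (splay_max t) = inorder t"
  by (induction t rule: splay_max.induct) (auto split: tree.splits)

lemma set_tree_splay_max [simp]: "set_tree (splay_max t) = set_tree t"
  by (metis inorder_splay_max set_inorder)

lemma size1_splay_max [simp]: "size1 (splay_max t) = size1 t"
  by (metis inorder_splay_max length_inorder size1_size)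

lemma splay_max_right: "splay_max t = \<langle>l, a, r\<rangle> \<Longrightarrow> r = \<langle>\<rangle>"
  by (induction t arbitrary: l a r rule: splay_max.induct) (auto split: tree.splits if_splits)

lemma splay_max_last:
  assumes "t \<noteq> \<langle>\<rangle>"
  obtains l where "splay_max t = \<langle>l, last (inorder t), \<langle>\<rangle>\<rangle>"
proof -
  obtain l a r where t: "splay_max t = \<langle>l, a, r\<rangle>"
    using assms by (metis splay_max_Leaf_iff neq_Leaf_iff)
  then have "r = \<langle>\<rangle>"
    by (rule splay_max_right)
  moreover have "inorder t = inorder l @ a # inorder r"
    using t inorder_splay_max[of t] by simp
  ultimately show ?thesis
    using that t by simp
qed

text \<open>As long as \<open>x\<close> is not among the top two nodes on the search path, the
  recursion enters a subtree that contains \<open>x\<close>. That subtree is nonempty, so the step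
  lifts its root, which is \<open>x\<close> by induction.\<close>

lemma splay_root:
  "sorted_wrt (\<prec>) (inorder t) \<Longrightarrow> x \<in> set_tree t \<Longrightarrow> \<exists>l r. splay (finish x) t = \<langle>l, x, r\<rangle>"
proof (induction "finish x" t rule: splay.induct)
  case (2 l a r)
  have l: "finish y < finish a" if "y \<in> set_tree l" for y
    using 2 that by (auto simp: sorted_wrt_append prec_def)
  have r: "finish a < finish y" if "y \<in> set_tree r" for y
    using 2 that by (auto simp: sorted_wrt_append prec_def)
  have srt: "sorted_wrt (\<prec>) (inorder l)" "sorted_wrt (\<prec>) (inorder r)"
    using 2 by (auto simp: sorted_wrt_append)
  have "x = a \<or> x \<in> set_tree l \<or> x \<in> set_tree r"
    using 2 by auto
  then consider "x = a" | "x \<in> set_tree l" "finish x < finish a" | "x \<in> set_tree r" "finish a < finish x"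
    using l r by blast
  then show ?case
  proof cases
    case 2
    then obtain ll b lr where lt: "l = \<langle>ll, b, lr\<rangle>"
      by (metis neq_Leaf_iff tree.set(1) empty_iff)
    have "y \<in> set_tree ll \<Longrightarrow> finish y < finish b" "y \<in> set_tree lr \<Longrightarrow> finish b < finish y" for y
      using srt lt by (auto simp: sorted_wrt_append prec_def)
    then consider "x = b" | "x \<in> set_tree ll" "finish x < finish b" | "x \<in> set_tree lr" "finish b < finish x"
      using 2 lt by auto
    then show ?thesis
    proof cases
      case 1
      then show ?thesis using 2 lt by simp
    next
      case c: 2
      then have "ll \<noteq> \<langle>\<rangle>" by auto
      moreover have "\<exists>l r. splay (finish x) ll = \<langle>l, x, r\<rangle>"
        using "2.hyps"(1)[OF 2(2) lt] c srt lt \<open>ll \<noteq> \<langle>\<rangle>\<close> by (auto simp: sorted_wrt_append)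
      ultimately show ?thesis
        using 2 c lt by auto
    next
      case c: 3
      then have "lr \<noteq> \<langle>\<rangle>" by auto
      moreover have "\<exists>l r. splay (finish x) lr = \<langle>l, x, r\<rangle>"
        using "2.hyps"(2)[OF 2(2) lt] c srt lt \<open>lr \<noteq> \<langle>\<rangle>\<close> by (auto simp: sorted_wrt_append)
      ultimately show ?thesis
        using 2 c lt by auto
    qed
  next
    case 3
    then obtain rl b rr where rt: "r = \<langle>rl, b, rr\<rangle>"
      by (metis neq_Leaf_iff tree.set(1) empty_iff)
    have "y \<in> set_tree rl \<Longrightarrow> finish y < finish b" "y \<in> set_tree rr \<Longrightarrow> finish b < finish y" for y
      using srt rt by (auto simp: sorted_wrt_append prec_def)
    then consider "x = b" | "x \<in> set_tree rl" "finish x < finish b" | "x \<in> set_tree rr" "finish b < finish x"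
      using 3 rt by auto
    then show ?thesis
    proof cases
      case 1
      then show ?thesis using 3 rt by simp
    next
      case c: 2
      then have "rl \<noteq> \<langle>\<rangle>" by auto
      moreover have "\<exists>l r. splay (finish x) rl = \<langle>l, x, r\<rangle>"
        using "2.hyps"(4)[OF _ 3(2) rt] 3 c srt rt \<open>rl \<noteq> \<langle>\<rangle>\<close> by (auto simp: sorted_wrt_append)
      ultimately show ?thesis
        using 3 c rt by auto
    next
      case c: 3
      then have "rr \<noteq> \<langle>\<rangle>" by auto
      moreover have "\<exists>l r. splay (finish x) rr = \<langle>l, x, r\<rangle>"
        using "2.hyps"(3)[OF _ 3(2) rt] 3 c srt rt \<open>rr \<noteq> \<langle>\<rangle>\<close> by (auto simp: sorted_wrt_append)
      ultimately show ?thesis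
        using 3 c rt by auto
    qed
  qed simp
qed simp

subsection \<open>Amortised cost of splaying\<close>

text \<open>The potential of Sleator and Tarjan: each node contributes the logarithm of the size of
  its subtree, measured by \<open>size1\<close>, which is positive even for the empty tree.\<close>

fun rank_sum :: "'a tree \<Rightarrow> real" where
  "rank_sum \<langle>\<rangle> = 0"
| "rank_sum \<langle>l, a, r\<rangle> = rank_sum l + log 2 (size1 l + size1 r) + rank_sum r"

lemma rank_sum_nonneg: "0 \<le> rank_sum t"
proof (induction t)
  case (Node l a r)
  have "1 \<le> size1 l" "1 \<le> size1 r"
    by (simp_all add: size1_size)
  then have "0 \<le> log 2 (size1 l + size1 r)"
    by simp
  then show ?case
    using Node by simp
qed simp

text \<open>The inequality of arithmetic and geometric means,
  \<open>4 * x * y \<le> (x + y)^2\<close>. The summand 2 it releases pays for the two nodes of a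
  double rotation.\<close>

lemma log_sum_le:
  fixes x y :: real
  assumes "0 < x" "0 < y"
  shows "2 + log 2 x + log 2 y \<le> 2 * log 2 (x + y)"
proof -
  have "4 * (x * y) \<le> (x + y)\<^sup>2"
    using sum_squares_bound[of x y] by (simp add: power2_eq_square algebra_simps)
  then have "log 2 (4 * (x * y)) \<le> log 2 ((x + y)\<^sup>2)"
    using assms by (intro log_mono) auto
  moreover have "log 2 (4 * (x * y)) = log 2 (2 ^ 2) + log 2 x + log 2 y"
    using assms by (simp add: log_mult)
  moreover have "log 2 (2 ^ 2 :: real) = 2"
    by (subst log_nat_power) auto
  ultimately show ?thesis
    using assms by (simp add: log_nat_power)
qed

text \<open>In the next two lemmas \<open>x\<close> and \<open>y\<close> are the sizes of the subtrees of the node that is moved up,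
  \<open>u\<close> and \<open>v\<close> those of the other subtrees below its grandparent.\<close>

lemma zig_zig_cost:
  fixes x y u v :: real
  assumes "1 \<le> x" "1 \<le> y" "1 \<le> u" "1 \<le> v"
  shows "2 + log 2 (y + (u + v)) + log 2 (u + v) + 2 * log 2 (x + y) \<le>
    3 * log 2 (x + y + (u + v)) + log 2 (x + y + u)"
proof -
  have "log 2 (y + (u + v)) \<le> log 2 (x + y + (u + v))" "log 2 (x + y) \<le> log 2 (x + y + u)"
    using assms by auto
  moreover have "2 + log 2 (x + y) + log 2 (u + v) \<le> 2 * log 2 (x + y + (u + v))"
    using assms by (intro log_sum_le) auto
  ultimately show ?thesis
    by linarith
qed

lemma zig_zag_cost:
  fixes x y u v :: real
  assumes "1 \<le> x" "1 \<le> y" "1 \<le> u" "1 \<le> v"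
  shows "2 + log 2 (u + x) + log 2 (y + v) + 2 * log 2 (x + y) \<le>
    3 * log 2 (u + (x + y) + v) + log 2 (u + (x + y))"
proof -
  have "log 2 (x + y) \<le> log 2 (u + (x + y))" "log 2 (x + y) \<le> log 2 (u + (x + y) + v)"
    using assms by auto
  moreover have "2 + log 2 (u + x) + log 2 (y + v) \<le> 2 * log 2 (u + (x + y) + v)"
    using log_sum_le[of "u + x" "y + v"] assms by (simp add: add_ac)
  ultimately show ?thesis
    by linarith
qed

text \<open>A single rotation at the end of the search path costs 2. One unit is paid here, the
  other by the additive 1 in \<open>splay_amortized\<close>.\<close>

lemma zig_cost:
  fixes x y z :: real
  assumes "1 \<le> x" "1 \<le> y" "1 \<le> z"
  shows "1 + log 2 (y + z) \<le> 3 * log 2 (x + y + z) + log 2 (x + y)"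
proof -
  have "log 2 (y + z) \<le> log 2 (x + y + z)" "0 \<le> log 2 (x + y)"
    using assms by auto
  moreover have "log 2 2 \<le> log 2 (x + y + z)"
    using assms by (subst log_le_cancel_iff) auto
  ultimately show ?thesis
    by simp
qed

lemma one_le_size1: "1 \<le> real (size1 t)"
  by (simp add: size1_size)

lemma log_size1_nonneg: "log 2 (size1 l) \<ge> 0"
  by (simp add: size1_size)

text \<open>The cost telescopes: a double step in \<open>t\<close> on top of splaying a subtree
  \<open>s\<close> costs at most \<open>3 * (log 2 (size1 t) - log 2 (size1 s))\<close>. Nodes are
  paired from the root down, so at most one unpaired step occurs, at the deep end, and the additive
  1 is spent once.\<close>

lemma splay_amortized:
  "T_splay k t + rank_sum (splay k t) - rank_sum t \<le> 3 * log 2 (size1 t) + 1"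
proof (induction k t rule: T_splay.induct)
  case (2 k l a r)
  note size = one_le_size1
  consider "k < finish a" | "finish a < k" | "k = finish a"
    by linarith
  then show ?case
  proof cases
    case lt: 1
    show ?thesis
    proof (cases l)
      case Leaf
      then show ?thesis using lt log_size1_nonneg[of "\<langle>l, a, r\<rangle>"] by (simp add: size1_size)
    next
      case l: (Node ll b lr)
      consider (zz) "k < finish b" "ll \<noteq> \<langle>\<rangle>" | (zag) "finish b < k" "lr \<noteq> \<langle>\<rangle>"
        | (zig) "\<not> (k < finish b \<and> ll \<noteq> \<langle>\<rangle>)" "\<not> (finish b < k \<and> lr \<noteq> \<langle>\<rangle>)"
        by blast
      then show ?thesis
      proof cases
        case zz
        obtain x c y where s: "splay k ll = \<langle>x, c, y\<rangle>"
          using zz by (metis splay_Leaf_iff neq_Leaf_iff)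
        then have s1: "real (size1 ll) = size1 x + size1 y"
          using size1_splay[of k ll] by simp
        have IH: "T_splay k ll + rank_sum (splay k ll) - rank_sum ll \<le> 3 * log 2 (size1 ll) + 1"
          using "2.IH"(1)[OF lt l] zz by blast
        show ?thesis
          using IH lt zz l s s1 zig_zig_cost[OF size[of x] size[of y] size[of lr] size[of r]]
          by (simp add: add_ac)
      next
        case zag
        obtain x c y where s: "splay k lr = \<langle>x, c, y\<rangle>"
          using zag by (metis splay_Leaf_iff neq_Leaf_iff)
        then have s1: "real (size1 lr) = size1 x + size1 y"
          using size1_splay[of k lr] by simp
        have IH: "T_splay k lr + rank_sum (splay k lr) - rank_sum lr \<le> 3 * log 2 (size1 lr) + 1"
          using "2.IH"(2)[OF lt l] zag by force
        show ?thesis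
          using IH lt zag l s s1 zig_zag_cost[OF size[of x] size[of y] size[of ll] size[of r]]
          by (simp add: add_ac)
      next
        case zig
        then have "splay k \<langle>l, a, r\<rangle> = \<langle>ll, b, \<langle>lr, a, r\<rangle>\<rangle>" "T_splay k \<langle>l, a, r\<rangle> = 2"
          using lt l by auto
        then show ?thesis
          using l zig_cost[OF size[of ll] size[of lr] size[of r]] by (simp add: add_ac)
      qed
    qed
  next
    case gt: 2
    then have ngt: "\<not> k < finish a" by simp
    show ?thesis
    proof (cases r)
      case Leaf
      then show ?thesis using gt log_size1_nonneg[of "\<langle>l, a, r\<rangle>"] by (simp add: size1_size)
    next
      case r: (Node rl b rr)
      consider (zz) "finish b < k" "rr \<noteq> \<langle>\<rangle>" | (zag) "k < finish b" "rl \<noteq> \<langle>\<rangle>"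
        | (zig) "\<not> (finish b < k \<and> rr \<noteq> \<langle>\<rangle>)" "\<not> (k < finish b \<and> rl \<noteq> \<langle>\<rangle>)"
        by blast
      then show ?thesis
      proof cases
        case zz
        obtain x c y where s: "splay k rr = \<langle>x, c, y\<rangle>"
          using zz by (metis splay_Leaf_iff neq_Leaf_iff)
        then have s1: "real (size1 rr) = size1 x + size1 y"
          using size1_splay[of k rr] by simp
        have IH: "T_splay k rr + rank_sum (splay k rr) - rank_sum rr \<le> 3 * log 2 (size1 rr) + 1"
          using "2.IH"(3)[OF ngt gt r] zz by blast
        show ?thesis
          using IH gt zz r s s1 zig_zig_cost[OF size[of y] size[of x] size[of rl] size[of l]]
          by (simp add: add_ac)
      next
        case zag
        obtain x c y where s: "splay k rl = \<langle>x, c, y\<rangle>"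
          using zag by (metis splay_Leaf_iff neq_Leaf_iff)
        then have s1: "real (size1 rl) = size1 x + size1 y"
          using size1_splay[of k rl] by simp
        have IH: "T_splay k rl + rank_sum (splay k rl) - rank_sum rl \<le> 3 * log 2 (size1 rl) + 1"
          using "2.IH"(4)[OF ngt gt r] zag by force
        show ?thesis
          using IH gt zag r s s1 zig_zag_cost[OF size[of y] size[of x] size[of rr] size[of l]]
          by (simp add: add_ac)
      next
        case zig
        then have "splay k \<langle>l, a, r\<rangle> = \<langle>\<langle>l, a, rl\<rangle>, b, rr\<rangle>" "T_splay k \<langle>l, a, r\<rangle> = 2"
          using gt r by auto
        then show ?thesis
          using r zig_cost[OF size[of rr] size[of rl] size[of l]] by (simp add: add_ac)
      qed
    qed
  next
    case 3
    then show ?thesis using log_size1_nonneg[of "\<langle>l, a, r\<rangle>"] by simp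
  qed
qed simp

lemma splay_max_amortized:
  "T_splay_max t + rank_sum (splay_max t) - rank_sum t \<le> 3 * log 2 (size1 t) + 1"
proof (induction t rule: T_splay_max.induct)
  case (2 l a)
  then show ?case using log_size1_nonneg[of "\<langle>l, a, \<langle>\<rangle>\<rangle>"] by simp
next
  case (3 l a rl b rr)
  note size = one_le_size1
  show ?case
  proof (cases "rr = \<langle>\<rangle>")
    case True
    then show ?thesis
      using zig_cost[OF size[of rr] size[of rl] size[of l]] by (simp add: add_ac)
  next
    case False
    then obtain x c y where s: "splay_max rr = \<langle>x, c, y\<rangle>"
      by (metis splay_max_Leaf_iff neq_Leaf_iff)
    then have "real (size1 rr) = size1 x + size1 y"
      using size1_splay_max[of rr] by simp
    then show ?thesis
      using 3 False s zig_zig_cost[OF size[of y] size[of x] size[of rl] size[of l]]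
      by (simp add: add_ac)
  qed
qed simp

section \<open>Solid paths\<close>

definition pairs :: "'a list \<Rightarrow> ('a \<times> 'a) set" where
  "pairs xs = set (zip xs (tl xs))"

lemma pairs_Nil [simp]: "pairs [] = {}"
  by (simp add: pairs_def)

lemma pairs_Cons: "pairs (x # xs) = (if xs = [] then {} else insert (x, hd xs) (pairs xs))"
  by (cases xs) (auto simp: pairs_def)

lemma pairs_append:
  "pairs (xs @ ys) = pairs xs \<union> pairs ys \<union> (if xs = [] \<or> ys = [] then {} else {(last xs, hd ys)})"
proof (induction xs)
  case (Cons x xs)
  have "pairs ((x # xs) @ ys) = (if xs @ ys = [] then {} else insert (x, hd (xs @ ys)) (pairs (xs @ ys)))"
    using pairs_Cons[of x "xs @ ys"] by simp
  then show ?case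
    using Cons.IH pairs_Cons[of x xs] by (auto simp: hd_append)
qed simp

lemma successively_pairs: "successively R xs \<longleftrightarrow> (\<forall>(x, y)\<in>pairs xs. R x y)"
  by (induction R xs rule: successively.induct) (auto simp: pairs_Cons)

lemma pairs_subset: "(a, b) \<in> pairs xs \<Longrightarrow> a \<in> set xs \<and> b \<in> set xs"
  by (induction xs) (auto simp: pairs_Cons split: if_splits)

lemma pairs_last: "distinct xs \<Longrightarrow> (a, b) \<in> pairs xs \<Longrightarrow> a \<noteq> last xs"
proof (induction xs)
  case (Cons x xs)
  then show ?case
    using pairs_subset[of a b xs] last_in_set[of xs] by (auto simp: pairs_Cons split: if_splits)
qed simp

lemma pairs_hd: "distinct xs \<Longrightarrow> (a, b) \<in> pairs xs \<Longrightarrow> b \<noteq> hd xs"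
proof (induction xs)
  case (Cons x xs)
  then show ?case
    using pairs_subset[of a b xs] hd_in_set[of xs] by (auto simp: pairs_Cons split: if_splits)
qed simp

lemma pairs_inj: "distinct xs \<Longrightarrow> (a, b) \<in> pairs xs \<Longrightarrow> (a', b) \<in> pairs xs \<Longrightarrow> a = a'"
proof (induction xs)
  case (Cons x xs)
  then show ?case
    using pairs_hd[of xs a b] pairs_hd[of xs a' b] by (auto simp: pairs_Cons split: if_splits)
qed simp

definition path :: "paths \<Rightarrow> interval \<Rightarrow> interval list" where
  "path F x = inorder (ST F x)"

text \<open>The solid edges, which are not stored: they are the neighbours in the inorder
  lists.\<close>

definition links :: "paths \<Rightarrow> (interval \<times> interval) set" where
  "links F = (\<Union>t\<in>set F. pairs (inorder t))"

definition ranks :: "paths \<Rightarrow> real" where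
  "ranks F = sum_list (map rank_sum F)"

text \<open>The trees partition \<open>A\<close> into paths of \<open>R\<close>; removing the nodes
  of each tree from \<open>A\<close> expresses disjointness. \<open>R\<close> is a parameter so
  that, once broken edges are cut, the same trees can be reinterpreted in another forest
  (\<open>solid_paths_change_rel\<close>).\<close>

fun solid_paths :: "(interval \<Rightarrow> interval \<Rightarrow> bool) \<Rightarrow> interval set \<Rightarrow> paths \<Rightarrow> bool" where
  "solid_paths R A [] \<longleftrightarrow> A = {}"
| "solid_paths R A (t # F) \<longleftrightarrow> t \<noteq> \<langle>\<rangle> \<and> successively R (inorder t) \<and> distinct (inorder t) \<and>
     set_tree t \<subseteq> A \<and> solid_paths R (A - set_tree t) F"

lemma ST_simps [simp]: "ST [] x = \<langle>\<rangle>" "ST (t # F) x = (if x \<in> set_tree t then t else ST F x)"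
  by (simp_all add: ST_def)

lemma links_simps [simp]: "links [] = {}" "links (t # F) = pairs (inorder t) \<union> links F"
  by (simp_all add: links_def)

lemma ranks_simps [simp]: "ranks [] = 0" "ranks (t # F) = rank_sum t + ranks F"
  by (simp_all add: ranks_def)

lemma ranks_nonneg: "0 \<le> ranks F"
  by (induction F) (auto simp: rank_sum_nonneg add_nonneg_nonneg)

lemma finite_links: "finite (links F)"
  by (simp add: links_def pairs_def)

lemma solid_paths_subset: "solid_paths R A F \<Longrightarrow> t \<in> set F \<Longrightarrow> set_tree t \<subseteq> A"
  by (induction F arbitrary: A) auto

lemma ST_empty: "solid_paths R A F \<Longrightarrow> x \<notin> A \<Longrightarrow> ST F x = \<langle>\<rangle>"
  by (induction F arbitrary: A) auto

lemma links_subset: "solid_paths R A F \<Longrightarrow> (a, b) \<in> links F \<Longrightarrow> a \<in> A \<and> b \<in> A"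
  using solid_paths_subset pairs_subset unfolding links_def by fastforce

lemma links_rel: "solid_paths R A F \<Longrightarrow> (a, b) \<in> links F \<Longrightarrow> R a b"
proof (induction F arbitrary: A)
  case (Cons t F)
  then show ?case by (auto simp: successively_pairs)
qed simp

lemma solid_paths_change_rel:
  "solid_paths R A F \<Longrightarrow> (\<And>a b. (a, b) \<in> links F \<Longrightarrow> R' a b) \<Longrightarrow> solid_paths R' A F"
proof (induction F arbitrary: A)
  case (Cons t F)
  then show ?case by (fastforce simp: successively_pairs)
qed simp

lemma links_unique: "solid_paths R A F \<Longrightarrow> (a, b) \<in> links F \<Longrightarrow> (a', b) \<in> links F \<Longrightarrow> a = a'"
proof (induction F arbitrary: A)
  case (Cons t F)
  have disj: "(c, b) \<in> pairs (inorder t) \<Longrightarrow> (c', b) \<notin> links F" for c c'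
    using Cons.prems pairs_subset[of c b "inorder t"] links_subset[of R "A - set_tree t" F c' b] by auto
  have "distinct (inorder t)" "solid_paths R (A - set_tree t) F"
    using Cons.prems by simp_all
  then show ?case
    using Cons.IH pairs_inj[of "inorder t" a b a'] disj[of a a'] disj[of a' a] Cons.prems(2,3)
    unfolding links_simps Un_iff by blast
qed simp

text \<open>At most one solid edge enters each node. Both the bound on the solidity and
  \<open>sum_at_most_one\<close> depend on it.\<close>

lemma links_inj: "solid_paths R A F \<Longrightarrow> inj_on snd (links F)"
proof (rule inj_onI)
  fix e e' assume "solid_paths R A F" "e \<in> links F" "e' \<in> links F" "snd e = snd e'"
  then show "e = e'"
    using links_unique by (metis prod.collapse)
qed

lemma links_path:
  "solid_paths R A F \<Longrightarrow> (a, b) \<in> links F \<Longrightarrow> (a, b) \<in> pairs (path F a) \<and> path F b = path F a"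
proof (induction F arbitrary: A)
  case (Cons t F)
  show ?case
  proof (cases "(a, b) \<in> pairs (inorder t)")
    case True
    then show ?thesis
      using pairs_subset[OF True] by (simp add: path_def)
  next
    case False
    then have "(a, b) \<in> links F"
      using Cons.prems by simp
    moreover from this have "a \<notin> set_tree t" "b \<notin> set_tree t"
      using Cons.prems links_subset[of R "A - set_tree t" F a b] by auto
    ultimately show ?thesis
      using Cons by (auto simp: path_def)
  qed
qed simp

lemma path_props:
  assumes "solid_paths R A F" "x \<in> A"
  shows "x \<in> set (path F x)" "set (path F x) \<subseteq> A" "distinct (path F x)" "successively R (path F x)"
    "\<And>y. y \<in> set (path F x) \<Longrightarrow> path F y = path F x"
proof -
  have "x \<in> set (path F x) \<and> set (path F x) \<subseteq> A \<and> distinct (path F x) \<and> successively R (path F x) \<and>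
    (\<forall>y. y \<in> set (path F x) \<longrightarrow> path F y = path F x)"
    using assms
  proof (induction F arbitrary: A)
    case (Cons t F)
    show ?case
    proof (cases "x \<in> set_tree t")
      case False
      then have "set (path F x) \<subseteq> A - set_tree t"
        using Cons by auto
      with False show ?thesis
        using Cons by (auto simp: path_def)
    qed (use Cons in \<open>auto simp: path_def\<close>)
  qed simp
  then show "x \<in> set (path F x)" "set (path F x) \<subseteq> A" "distinct (path F x)" "successively R (path F x)"
    "\<And>y. y \<in> set (path F x) \<Longrightarrow> path F y = path F x"
    by blast+
qed

lemma update_notin:
  "solid_paths R A F \<Longrightarrow> x \<notin> A \<Longrightarrow> filter (\<lambda>t. x \<notin> set_tree t) F = F"
  by (induction F arbitrary: A) auto

text \<open>Isolates the tree of \<open>x\<close> from the remaining trees \<open>G\<close>,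
  wherever it occurs in the list. Every operation replaces this tree and keeps
  \<open>G\<close>.\<close>

lemma ST_cases:
  assumes "solid_paths R A F" "x \<in> A"
  obtains G where "x \<in> set_tree (ST F x)" "set_tree (ST F x) \<subseteq> A" "successively R (path F x)"
    "distinct (path F x)" "solid_paths R (A - set_tree (ST F x)) G"
    "\<And>ts. update F x ts = filter (\<lambda>t. t \<noteq> \<langle>\<rangle>) ts @ G"
    "links F = pairs (path F x) \<union> links G" "ranks F = rank_sum (ST F x) + ranks G"
    "\<And>y. y \<notin> set_tree (ST F x) \<Longrightarrow> ST F y = ST G y"
proof -
  have "x \<in> set_tree (ST F x) \<and> set_tree (ST F x) \<subseteq> A \<and> successively R (path F x) \<and> distinct (path F x) \<and>
     solid_paths R (A - set_tree (ST F x)) (filter (\<lambda>t. x \<notin> set_tree t) F) \<and>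
     links F = pairs (path F x) \<union> links (filter (\<lambda>t. x \<notin> set_tree t) F) \<and>
     ranks F = rank_sum (ST F x) + ranks (filter (\<lambda>t. x \<notin> set_tree t) F) \<and>
     (\<forall>y. y \<notin> set_tree (ST F x) \<longrightarrow> ST F y = ST (filter (\<lambda>t. x \<notin> set_tree t) F) y)"
    using assms
  proof (induction F arbitrary: A)
    case (Cons t F)
    show ?case
    proof (cases "x \<in> set_tree t")
      case True
      then have "filter (\<lambda>t. x \<notin> set_tree t) F = F"
        using Cons.prems by (intro update_notin[of R "A - set_tree t"]) auto
      then show ?thesis
        using Cons.prems True by (auto simp: path_def)
    next
      case False
      let ?G = "filter (\<lambda>t. x \<notin> set_tree t) F"
      have x: "x \<in> A - set_tree t" "solid_paths R (A - set_tree t) F"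
        using False Cons.prems by auto
      note IH = Cons.IH[OF x(2,1)]
      have eq: "A - set_tree (ST F x) - set_tree t = A - set_tree t - set_tree (ST F x)"
        by blast
      have "set_tree t \<subseteq> A - set_tree (ST F x)"
        using IH Cons.prems by auto
      then have "solid_paths R (A - set_tree (ST F x)) (t # ?G)"
        using IH Cons.prems eq by simp
      then show ?thesis
        using IH False by (auto simp: path_def)
    qed
  qed simp
  then show ?thesis
    by (elim conjE, intro that[of "filter (\<lambda>t. x \<notin> set_tree t) F"])
      (assumption | simp only: update_def | erule allE, erule mp, assumption)+
qed

subsection \<open>Operations on solid paths\<close>

text \<open>The summand 2 makes \<open>lg n\<close> at least 1 also for \<open>n = 0\<close>.\<close>

definition lg :: "nat \<Rightarrow> real" where
  "lg n = log 2 (real n + 2)"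

lemma lg_ge_1: "1 \<le> lg n"
proof -
  have "log 2 2 \<le> lg n"
    unfolding lg_def by (subst log_le_cancel_iff) auto
  then show ?thesis by simp
qed

text \<open>Edges and nodes are separate parameters: while an interval is being inserted, the trees
  already contain it, but their edges still belong to the old forest.\<close>

locale solid =
  fixes I A :: "interval set"
  assumes good: "good I" and finite_A: "finite A"
begin

abbreviation inv :: "paths \<Rightarrow> bool" where
  "inv \<equiv> solid_paths (edge I) A"

abbreviation L :: real where
  "L \<equiv> lg (card A)"

lemma path_sorted: "successively (edge I) xs \<Longrightarrow> sorted_wrt (\<prec>) xs"
proof -
  assume "successively (edge I) xs"
  then have "successively (\<prec>) xs"
    by (rule successively_mono) (simp add: prec_def edge_less[OF good])
  then show ?thesis
    by (subst (asm) successively_conv_sorted_wrt) (auto simp: transp_def prec_def)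
qed

lemma log_size_le:
  assumes "set_tree t \<subseteq> A" "distinct (inorder t)"
  shows "log 2 (size1 t) \<le> L"
proof -
  have "size t \<le> card A"
    using assms distinct_card[OF assms(2)] card_mono[OF finite_A assms(1)] by simp
  then show ?thesis
    unfolding lg_def by (simp add: size1_size)
qed

text \<open>The factor 3 and the additive 1 of the amortised bounds combine to 4, since
  \<open>L\<close> is at least 1.\<close>

lemma splay_cost:
  assumes "set_tree t \<subseteq> A" "distinct (inorder t)"
  shows "T_splay k t + rank_sum (splay k t) \<le> rank_sum t + 4 * L"
    and "T_splay_max t + rank_sum (splay_max t) \<le> rank_sum t + 4 * L"
  using splay_amortized[of k t] splay_max_amortized[of t] log_size_le[OF assms] lg_ge_1[of "card A"]
  by linarith+

text \<open>For operations that only reshape one tree: paths and solid edges depend on the inorder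
  list alone, so just the ranks change.\<close>

lemma restructure:
  assumes "inv F" "x \<in> A" "inorder t = path F x"
  shows "inv (update F x [t])" "path (update F x [t]) = path F" "links (update F x [t]) = links F"
    "ranks (update F x [t]) = ranks F + rank_sum t - rank_sum (ST F x)"
proof -
  obtain G where G: "x \<in> set_tree (ST F x)" "set_tree (ST F x) \<subseteq> A" "successively (edge I) (path F x)"
    "distinct (path F x)" "solid_paths (edge I) (A - set_tree (ST F x)) G"
    "\<And>ts. update F x ts = filter (\<lambda>t. t \<noteq> \<langle>\<rangle>) ts @ G"
    "links F = pairs (path F x) \<union> links G" "ranks F = rank_sum (ST F x) + ranks G"
    "\<And>y. y \<notin> set_tree (ST F x) \<Longrightarrow> ST F y = ST G y"
    using ST_cases[OF assms(1,2)] by blast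
  have s: "set_tree t = set_tree (ST F x)"
    using assms(3) unfolding path_def by (metis set_inorder)
  then have "t \<noteq> \<langle>\<rangle>"
    using G(1) by auto
  then have u: "update F x [t] = t # G"
    using G(6) by simp
  show "inv (update F x [t])" "links (update F x [t]) = links F"
    "ranks (update F x [t]) = ranks F + rank_sum t - rank_sum (ST F x)"
    using u G s assms(3) \<open>t \<noteq> \<langle>\<rangle>\<close> by simp_all
  show "path (update F x [t]) = path F"
  proof
    fix y
    show "path (update F x [t]) y = path F y"
    proof (cases "y \<in> set_tree t")
      case True
      then have "y \<in> set (path F x)"
        using s by (simp add: path_def)
      then show ?thesis
        using True path_props(5)[OF assms(1,2), of y] assms(3) u by (simp add: path_def)
    next
      case False
      then show ?thesis
        using G(9)[of y] s u by (simp add: path_def)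
    qed
  qed
qed

lemma splay_at:
  assumes "inv F" "x \<in> A"
  obtains l r where "splay (finish x) (ST F x) = \<langle>l, x, r\<rangle>" "path F x = inorder l @ x # inorder r"
    "set_tree l \<subseteq> A" "set_tree r \<subseteq> A" "distinct (inorder l)" "distinct (inorder r)"
    "x \<notin> set_tree l" "x \<notin> set_tree r" "set_tree l \<inter> set_tree r = {}"
    "T_splay (finish x) (ST F x) + rank_sum \<langle>l, x, r\<rangle> \<le> rank_sum (ST F x) + 4 * L"
proof -
  have x: "x \<in> set_tree (ST F x)" and t: "set_tree (ST F x) \<subseteq> A" "distinct (inorder (ST F x))"
    using path_props(1-4)[OF assms] by (auto simp: path_def)
  have "sorted_wrt (\<prec>) (inorder (ST F x))"
    using path_sorted path_props(4)[OF assms] by (simp add: path_def)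
  then obtain l r where s: "splay (finish x) (ST F x) = \<langle>l, x, r\<rangle>"
    using splay_root x by blast
  then have p: "inorder (ST F x) = inorder l @ x # inorder r"
    using inorder_splay[of "finish x" "ST F x"] by simp
  have st: "set_tree (ST F x) = set_tree l \<union> insert x (set_tree r)"
    using arg_cong[OF p, of set] by simp
  have dist: "distinct (inorder l)" "distinct (inorder r)" "x \<notin> set_tree l" "x \<notin> set_tree r"
    "set_tree l \<inter> set_tree r = {}"
    using t(2) unfolding p by auto
  show ?thesis
  proof (rule that[OF s _ _ _ dist])
    show "path F x = inorder l @ x # inorder r" "set_tree l \<subseteq> A" "set_tree r \<subseteq> A"
      using p t(1) st by (simp_all add: path_def)
    show "T_splay (finish x) (ST F x) + rank_sum \<langle>l, x, r\<rangle> \<le> rank_sum (ST F x) + 4 * L"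
      using splay_cost(1)[OF t, of "finish x"] unfolding s .
  qed
qed

lemma max_ST_spec:
  assumes "inv F" "x \<in> A"
  obtains F' c where "max_ST x F = (last (path F x), F', c)" "inv F'" "path F' = path F"
    "links F' = links F" "c + ranks F' \<le> ranks F + 8 * L"
proof -
  let ?t = "splay (finish x) (ST F x)"
  have x: "x \<in> set_tree (ST F x)" and t: "set_tree (ST F x) \<subseteq> A" "distinct (inorder (ST F x))"
    using path_props(1-4)[OF assms] by (auto simp: path_def)
  then have "?t \<noteq> \<langle>\<rangle>" by auto
  then obtain l where l: "splay_max ?t = \<langle>l, last (path F x), \<langle>\<rangle>\<rangle>"
    using splay_max_last[of ?t] by (auto simp: path_def)
  have "inorder (splay_max ?t) = path F x"
    by (simp add: path_def)
  note R = restructure[OF assms this]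
  have "max_ST x F = (last (path F x), update F x [splay_max ?t],
      T_splay (finish x) (ST F x) + T_splay_max ?t)"
    using l by (simp add: max_ST_def Let_def)
  then show ?thesis
  proof (rule that[OF _ R(1-3)])
    show "real (T_splay (finish x) (ST F x) + T_splay_max ?t) + ranks (update F x [splay_max ?t])
        \<le> ranks F + 8 * L"
      using R(4) splay_cost(1)[OF t, of "finish x"] splay_cost(2)[of ?t] t by simp
  qed
qed

lemma find_ST_spec:
  assumes "inv F" "m \<in> A"
  obtains F' c where "find_ST m i F = (i \<in> set (path F m), F', c)" "inv F'" "path F' = path F"
    "links F' = links F" "c + ranks F' \<le> ranks F + 8 * L"
proof -
  let ?t = "splay (finish m) (ST F m)"
  let ?t' = "splay (finish i) ?t"
  have t: "set_tree (ST F m) \<subseteq> A" "distinct (inorder (ST F m))" "sorted_wrt (\<prec>) (inorder (ST F m))"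
    using path_props(1-4)[OF assms] path_sorted by (auto simp: path_def)
  have "inorder ?t' = path F m"
    by (simp add: path_def)
  note R = restructure[OF assms this]
  have "root_of ?t' = Some i \<longleftrightarrow> i \<in> set (path F m)"
  proof
    assume "root_of ?t' = Some i"
    then have "i \<in> set_tree ?t'"
      by (cases ?t') (simp_all add: root_of_def del: set_tree_splay)
    then show "i \<in> set (path F m)"
      by (simp add: path_def)
  next
    assume "i \<in> set (path F m)"
    then show "root_of ?t' = Some i"
      using splay_root[of ?t i] t(3) by (auto simp: root_of_def path_def)
  qed
  then have "find_ST m i F = (i \<in> set (path F m), update F m [?t'],
      T_splay (finish m) (ST F m) + T_splay (finish i) ?t)"
    by (simp add: find_ST_def Let_def)
  then show ?thesis
  proof (rule that[OF _ R(1-3)])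
    show "real (T_splay (finish m) (ST F m) + T_splay (finish i) ?t) + ranks (update F m [?t'])
        \<le> ranks F + 8 * L"
      using R(4) splay_cost(1)[OF t(1,2), of "finish m"] splay_cost(1)[of ?t "finish i"] t by simp
  qed
qed

lemma pred_ST_spec:
  assumes "inv F" "x \<in> A"
  obtains F' c xs ys where "path F x = xs @ x # ys"
    "pred_ST x F = (if xs = [] then None else Some (last xs), F', c)" "inv F'" "path F' = path F"
    "links F' = links F" "c + ranks F' \<le> ranks F + 8 * L"
proof -
  obtain l r where s: "splay (finish x) (ST F x) = \<langle>l, x, r\<rangle>" "path F x = inorder l @ x # inorder r"
    "set_tree l \<subseteq> A" "distinct (inorder l)"
    "T_splay (finish x) (ST F x) + rank_sum \<langle>l, x, r\<rangle> \<le> rank_sum (ST F x) + 4 * L"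
    using splay_at[OF assms] by metis
  have "inorder \<langle>splay_max l, x, r\<rangle> = path F x"
    using s(2) by simp
  note R = restructure[OF assms this]
  have root: "root_of (splay_max l) = (if inorder l = [] then None else Some (last (inorder l)))"
  proof (cases "l = \<langle>\<rangle>")
    case False
    then show ?thesis
      by (rule splay_max_last) (simp add: root_of_def False)
  qed (simp add: root_of_def)
  show ?thesis
  proof (rule that[OF s(2) _ R(1-3)])
    show "pred_ST x F = (if inorder l = [] then None else Some (last (inorder l)),
        update F x [\<langle>splay_max l, x, r\<rangle>], T_splay (finish x) (ST F x) + T_splay_max l)"
      unfolding pred_ST_def s(1) root[symmetric] by simp
    show "real (T_splay (finish x) (ST F x) + T_splay_max l) +
        ranks (update F x [\<langle>splay_max l, x, r\<rangle>]) \<le> ranks F + 8 * L"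
      using R(4) splay_cost(2)[OF s(3,4)] s(5) by simp
  qed
qed

lemma split_ST_spec:
  assumes "inv F" "x \<in> A"
  obtains F' c xs ys where "path F x = xs @ x # ys" "split_ST x F = (F', c)" "inv F'"
    "\<And>y. path F' y = (if y \<in> set xs then xs else if y \<in> set (x # ys) then x # ys else path F y)"
    "links F = links F' \<union> (if xs = [] then {} else {(last xs, x)})"
    "c + ranks F' \<le> ranks F + 4 * L"
proof -
  obtain l r where s: "splay (finish x) (ST F x) = \<langle>l, x, r\<rangle>" "path F x = inorder l @ x # inorder r"
    "set_tree l \<subseteq> A" "set_tree r \<subseteq> A" "distinct (inorder l)" "distinct (inorder r)"
    "x \<notin> set_tree l" "x \<notin> set_tree r" "set_tree l \<inter> set_tree r = {}"
    "T_splay (finish x) (ST F x) + rank_sum \<langle>l, x, r\<rangle> \<le> rank_sum (ST F x) + 4 * L"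
    using splay_at[OF assms] by metis
  obtain G where G: "successively (edge I) (path F x)"
    "solid_paths (edge I) (A - set_tree (ST F x)) G"
    "\<And>ts. update F x ts = filter (\<lambda>t. t \<noteq> \<langle>\<rangle>) ts @ G"
    "links F = pairs (path F x) \<union> links G" "ranks F = rank_sum (ST F x) + ranks G"
    "\<And>y. y \<notin> set_tree (ST F x) \<Longrightarrow> ST F y = ST G y"
    using ST_cases[OF assms] by metis
  have st: "set_tree (ST F x) = set_tree l \<union> insert x (set_tree r)"
    using arg_cong[OF s(2), of set] by (simp add: path_def)
  let ?r = "\<langle>\<langle>\<rangle>, x, r\<rangle>"
  let ?F = "update F x [l, ?r]"
  have sc: "successively (edge I) (inorder l)" "successively (edge I) (inorder ?r)"
    using G(1) s(2) by (simp_all add: successively_append_iff)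
  have eq: "A - set_tree (ST F x) = A - set_tree l - set_tree ?r"
    unfolding st by auto
  have inv_r: "solid_paths (edge I) (A - set_tree l) (?r # G)"
    using s G(2) sc assms(2) eq by auto
  \<comment> \<open>Cutting off the left subtree can only lower the rank of \<open>x\<close>, so the
    split costs no more than its splay.\<close>
  have rank_r: "log 2 (1 + real (size1 r)) \<le> log 2 (real (size1 l) + real (size1 r))"
    using one_le_size1[of l] one_le_size1[of r] by simp
  show ?thesis
  proof (rule that[OF s(2), of ?F "T_splay (finish x) (ST F x)"])
    show "split_ST x F = (?F, T_splay (finish x) (ST F x))"
      unfolding split_ST_def s(1) by simp
    show "inv ?F"
    proof (cases "l = \<langle>\<rangle>")
      case True
      then show ?thesis using inv_r G(3) by simp
    next
      case False
      then have "?F = l # ?r # G" using G(3) by simp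
      then show ?thesis using inv_r s sc False by (simp only: solid_paths.simps(2)[of _ _ l]) simp
    qed
    show "path ?F y = (if y \<in> set (inorder l) then inorder l
        else if y \<in> set (x # inorder r) then x # inorder r else path F y)" for y
      using G(3,6) st by (cases "l = \<langle>\<rangle>") (auto simp: path_def)
    show "links F = links ?F \<union> (if inorder l = [] then {} else {(last (inorder l), x)})"
      using G(3,4) s(2) by (cases "l = \<langle>\<rangle>") (auto simp: pairs_append)
    show "T_splay (finish x) (ST F x) + ranks ?F \<le> ranks F + 4 * L"
      using G(3,5) s(10) rank_r by (cases "l = \<langle>\<rangle>") (auto simp: add_ac)
  qed
qed

lemma delete_ST_spec:
  assumes "inv F" "x \<in> A"
  obtains F' c xs ys where "path F x = xs @ x # ys" "delete_ST x F = (F', c)"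
    "solid_paths (edge I) (A - {x}) F'"
    "links F = links F' \<union> (if xs = [] then {} else {(last xs, x)}) \<union> (if ys = [] then {} else {(x, hd ys)})"
    "c + ranks F' \<le> ranks F + 4 * L"
proof -
  obtain l r where s: "splay (finish x) (ST F x) = \<langle>l, x, r\<rangle>" "path F x = inorder l @ x # inorder r"
    "set_tree l \<subseteq> A" "set_tree r \<subseteq> A" "distinct (inorder l)" "distinct (inorder r)"
    "x \<notin> set_tree l" "x \<notin> set_tree r" "set_tree l \<inter> set_tree r = {}"
    "T_splay (finish x) (ST F x) + rank_sum \<langle>l, x, r\<rangle> \<le> rank_sum (ST F x) + 4 * L"
    using splay_at[OF assms] by metis
  obtain G where G: "successively (edge I) (path F x)"
    "solid_paths (edge I) (A - set_tree (ST F x)) G"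
    "\<And>ts. update F x ts = filter (\<lambda>t. t \<noteq> \<langle>\<rangle>) ts @ G"
    "links F = pairs (path F x) \<union> links G" "ranks F = rank_sum (ST F x) + ranks G"
    using ST_cases[OF assms] by metis
  have st: "set_tree (ST F x) = set_tree l \<union> insert x (set_tree r)"
    using arg_cong[OF s(2), of set] by (simp add: path_def)
  let ?F = "update F x [l, r]"
  have sc: "successively (edge I) (inorder l)" "successively (edge I) (inorder r)"
    using G(1) s(2) by (auto simp: successively_append_iff successively_Cons)
  have eq: "A - set_tree (ST F x) = A - {x} - set_tree l - set_tree r"
    unfolding st by auto
  have inv_r: "solid_paths (edge I) (A - {x} - set_tree l) (filter (\<lambda>t. t \<noteq> \<langle>\<rangle>) [r] @ G)"
    using s G(2) sc assms(2) eq by (cases "r = \<langle>\<rangle>") auto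
  have "filter (\<lambda>t. t \<noteq> \<langle>\<rangle>) [l, r] = (if l = \<langle>\<rangle> then [] else [l]) @ filter (\<lambda>t. t \<noteq> \<langle>\<rangle>) [r]"
    by simp
  then have F: "?F = (if l = \<langle>\<rangle> then [] else [l]) @ filter (\<lambda>t. t \<noteq> \<langle>\<rangle>) [r] @ G"
    using G(3) by simp
  have rank: "0 \<le> log 2 (real (size1 l) + real (size1 r))"
    using one_le_size1[of l] one_le_size1[of r] by simp
  show ?thesis
  proof (rule that[OF s(2), of ?F "T_splay (finish x) (ST F x)"])
    show "delete_ST x F = (?F, T_splay (finish x) (ST F x))"
      unfolding delete_ST_def s(1) by simp
    show "solid_paths (edge I) (A - {x}) ?F"
      unfolding F using inv_r s sc by (cases "l = \<langle>\<rangle>") (simp_all del: filter.simps, blast)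
    have "pairs (path F x) = pairs (inorder l) \<union> pairs (inorder r) \<union>
        (if inorder l = [] then {} else {(last (inorder l), x)}) \<union>
        (if inorder r = [] then {} else {(x, hd (inorder r))})"
      unfolding s(2) pairs_append pairs_Cons by auto
    moreover have "links ?F = pairs (inorder l) \<union> pairs (inorder r) \<union> links G"
      using G(3) by auto
    ultimately show "links F = links ?F \<union> (if inorder l = [] then {} else {(last (inorder l), x)}) \<union>
        (if inorder r = [] then {} else {(x, hd (inorder r))})"
      using G(4) by blast
    have "ranks ?F = rank_sum l + rank_sum r + ranks G"
      using G(3) by auto
    then show "T_splay (finish x) (ST F x) + ranks ?F \<le> ranks F + 4 * L"
      using G(5) s(10) rank by simp
  qed
qed

text \<open>The constant 13 consists of three splays at 4 each and 1 for the root: attaching the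
  second tree raises no other rank, and the new rank of the root is at most
  \<open>L\<close>.\<close>

lemma join_ST_spec:
  assumes "inv F" "a \<in> A" "b \<in> A" "b \<notin> set (path F a)" "edge I (last (path F a)) (hd (path F b))"
  obtains F' c where "join_ST a b F = (F', c)" "inv F'"
    "path F' a = path F a @ path F b" "path F' b = path F a @ path F b"
    "links F' = insert (last (path F a), hd (path F b)) (links F)"
    "c + ranks F' \<le> ranks F + 13 * L"
proof -
  let ?s = "ST F a" and ?t = "ST F b"
  let ?s' = "splay_max (splay (finish a) ?s)" and ?t' = "splay (finish b) ?t"
  obtain G where G: "a \<in> set_tree ?s" "set_tree ?s \<subseteq> A" "successively (edge I) (path F a)"
    "distinct (path F a)" "solid_paths (edge I) (A - set_tree ?s) G"
    "\<And>ts. update F a ts = filter (\<lambda>t. t \<noteq> \<langle>\<rangle>) ts @ G"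
    "links F = pairs (path F a) \<union> links G" "ranks F = rank_sum ?s + ranks G"
    "\<And>y. y \<notin> set_tree ?s \<Longrightarrow> ST F y = ST G y"
    using ST_cases[OF assms(1,2)] by metis
  have "b \<in> A - set_tree ?s"
    using assms(3,4) by (simp add: path_def)
  then have STG: "ST G b = ?t" "path G b = path F b"
    using G(9)[of b] by (auto simp: path_def)
  obtain H where H: "b \<in> set_tree ?t" "set_tree ?t \<subseteq> A - set_tree ?s" "successively (edge I) (path F b)"
    "distinct (path F b)" "solid_paths (edge I) (A - set_tree ?s - set_tree ?t) H"
    "\<And>ts. update G b ts = filter (\<lambda>t. t \<noteq> \<langle>\<rangle>) ts @ H"
    "links G = pairs (path F b) \<union> links H" "ranks G = rank_sum ?t + ranks H"
    using ST_cases[OF G(5) \<open>b \<in> A - set_tree ?s\<close>] unfolding STG by metis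
  have "splay (finish a) ?s \<noteq> \<langle>\<rangle>" using G(1) by auto
  then obtain l where l: "?s' = \<langle>l, last (path F a), \<langle>\<rangle>\<rangle>"
    using splay_max_last[of "splay (finish a) ?s"] by (auto simp: path_def)
  define u where "u = \<langle>l, last (path F a), ?t'\<rangle>"
  have "inorder l @ [last (path F a)] = path F a"
    using l inorder_splay_max[of "splay (finish a) ?s"] by (simp add: path_def)
  then have u: "inorder u = path F a @ path F b"
    unfolding u_def by (metis append.assoc inorder.simps(2) inorder_splay path_def)
  have su: "set_tree u = set_tree ?s \<union> set_tree ?t"
    using arg_cong[OF u, of set] by (simp add: path_def)
  have disj: "set_tree ?s \<inter> set_tree ?t = {}"
    using H(2) by auto
  have ne: "path F a \<noteq> []" "path F b \<noteq> []"
    using G(1) H(1) by (auto simp: path_def)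
  define F' where "F' = update (update F a []) b [u]"
  have F': "F' = u # H"
    unfolding F'_def using G(6) H(6) by (simp add: u_def)
  have sum: "rank_sum ?s' = rank_sum l + log 2 (size1 l + 1)"
    using l by simp
  have "set_tree ?t \<subseteq> A" "distinct (inorder ?t)" "distinct (inorder ?s)" "distinct (inorder u)" "set_tree u \<subseteq> A"
    using H G disj u su by (auto simp: path_def)
  note len = splay_cost(1)[OF this(1,2), of "finish b"] splay_cost(1)[OF G(2) this(3), of "finish a"]
    splay_cost(2)[of "splay (finish a) ?s"] log_size_le[OF this(5,4)]
  have "0 \<le> log 2 (real (size1 l + 1))"
    using one_le_size1[of l] by simp
  moreover have "rank_sum u = rank_sum l + log 2 (size1 u) + rank_sum ?t'"
    by (simp add: u_def)
  ultimately have "rank_sum u \<le> rank_sum ?s' + rank_sum ?t' + L"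
    using len(4) sum by linarith
  show ?thesis
  proof (rule that)
    show "join_ST a b F =
        (F', T_splay (finish a) ?s + T_splay (finish b) ?t + T_splay_max (splay (finish a) ?s))"
      by (simp add: join_ST_def Let_def l F'_def u_def)
    have "solid_paths (edge I) (A - set_tree u) H"
      using H(5) su by (simp add: Diff_eq Int_assoc)
    then show "inv F'"
      using F' u su G H assms(5) ne disj
      by (auto simp: successively_append_iff path_def)
    show "path F' a = path F a @ path F b" "path F' b = path F a @ path F b"
      using F' u su G(1) H(1) by (simp_all add: path_def)
    show "links F' = insert (last (path F a), hd (path F b)) (links F)"
      using F' u ne G(7) H(7) by (auto simp: pairs_append)
    show "real (T_splay (finish a) ?s + T_splay (finish b) ?t + T_splay_max (splay (finish a) ?s)) +
        ranks F' \<le> ranks F + 13 * L"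
      using F' G(8) H(8) len \<open>rank_sum u \<le> rank_sum ?s' + rank_sum ?t' + L\<close>
        \<open>distinct (inorder ?s)\<close> G(2) by simp
  qed
qed

end

section \<open>The potential\<close>

definition solidity :: "interval set \<Rightarrow> paths \<Rightarrow> real" where
  "solidity I F = sum (ratio I) (links F)"

text \<open>Every ratio is at most 1 and solid edges have distinct targets in \<open>I\<close>.
  Hence the deficit in the potential is nonnegative.\<close>

lemma solidity_bounds:
  assumes "good I" "solid_paths (edge I) A F"
  shows "0 \<le> solidity I F" "solidity I F \<le> card I"
proof -
  have r: "0 \<le> ratio I e \<and> ratio I e \<le> 1 \<and> snd e \<in> I" if "e \<in> links F" for e
    using links_rel[OF assms(2), of "fst e" "snd e"] that ratio_bounds[OF assms(1), of "fst e" "snd e"]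
      edge_mem[OF assms(1), of "fst e" "snd e"] by auto
  then show "0 \<le> solidity I F"
    unfolding solidity_def by (intro sum_nonneg) auto
  have "solidity I F \<le> card (links F)"
    unfolding solidity_def using r sum_bounded_above[of "links F" "ratio I" 1] by simp
  also have "card (links F) = card (snd ` links F)"
    using card_image[OF links_inj[OF assms(2)]] by simp
  also have "\<dots> \<le> card I"
    using r good_finite[OF assms(1)] by (intro of_nat_mono card_mono) auto
  finally show "solidity I F \<le> card I" by simp
qed

text \<open>The factor 28 is the amortised cost of one iteration of \<open>expose\<close> in units of \<open>lg n\<close>: 4 for the
  split, 13 for the join, 8 for the maximum and 3 for the search in \<open>T(I)\<close>.\<close>

definition potential :: "interval set \<Rightarrow> paths \<Rightarrow> real" where
  "potential I F = ranks F + 28 * lg (card I) * (card I - solidity I F)"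

lemma potential_nonneg: "good I \<Longrightarrow> solid_paths (edge I) I F \<Longrightarrow> 0 \<le> potential I F"
  using solidity_bounds[of I I F] ranks_nonneg[of F] lg_ge_1[of "card I"]
  unfolding potential_def by (intro add_nonneg_nonneg mult_nonneg_nonneg) auto

lemma lg_mono: "m \<le> n \<Longrightarrow> lg m \<le> lg n"
  unfolding lg_def by simp

text \<open>Controls the scale of the potential when the set grows. The increment of
  \<open>lg\<close> is at most \<open>1 / ((n + 2) * ln 2)\<close>, so multiplying it by
  \<open>x \<le> n\<close> leaves at most \<open>1 / ln 2\<close>.\<close>

lemma lg_Suc: "lg (Suc n) * x \<le> lg n * x + 2" if "0 \<le> x" "x \<le> n" for x :: real
proof -
  have "lg (Suc n) - lg n = log 2 ((real n + 3) / (real n + 2))"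
    unfolding lg_def by (simp add: log_divide add_ac)
  also have "\<dots> = ln (1 + 1 / (real n + 2)) / ln 2"
    by (simp add: log_def field_simps)
  also have "\<dots> \<le> (1 / (real n + 2)) / ln 2"
    by (intro divide_right_mono ln_add_one_self_le_self) auto
  finally have d: "lg (Suc n) - lg n \<le> (1 / (real n + 2)) / ln 2" .
  have ln2: "1 / 2 \<le> ln (2::real)"
    using ln_ge_iff[of 2 "1/2"] exp_half_le2 by simp
  have "(lg (Suc n) - lg n) * x \<le> (1 / (real n + 2)) / ln 2 * x"
    using d that by (intro mult_right_mono) auto
  also have "\<dots> = (x / (real n + 2)) / ln 2"
    by simp
  also have "\<dots> \<le> 1 / ln 2"
    using that by (intro divide_right_mono) auto
  also have "\<dots> \<le> 2"
    using ln2 by (simp add: divide_simps)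
  finally show ?thesis
    by (simp add: algebra_simps)
qed

lemma ln_le_lg: "ln (real n) \<le> lg n"
proof (cases "n = 0")
  case False
  then have "0 \<le> ln (real n)" "ln (real n) \<le> ln (real n + 2)"
    by auto
  moreover have "ln (real n + 2) \<le> ln (real n + 2) / ln 2"
    using ln_2_less_1 calculation by (simp add: le_divide_eq mult_left_le)
  ultimately show ?thesis
    by (simp add: lg_def log_def)
qed (use lg_ge_1[of 0] in simp)

text \<open>The height contributes 2, and the empty tree visited last contributes 1.\<close>

lemma T_avl_lg:
  assumes "tree_of I T" "k \<le> height T + 1"
  shows "real k \<le> 3 * lg (card I)"
proof -
  have "height T \<le> 2 * log 2 (size1 T)"
    using assms avl_ok_log_height by (simp add: tree_of_def)
  also have "log 2 (size1 T) \<le> lg (card I)"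
    unfolding lg_def using size_tree_of[OF assms(1)] by (simp add: size1_size)
  finally show ?thesis
    using assms(2) lg_ge_1[of "card I"] by simp
qed

section \<open>Exposing\<close>

lemma weight_mono_path:
  "good I \<Longrightarrow> successively (edge I) xs \<Longrightarrow> xs \<noteq> [] \<Longrightarrow>
    weight I (hd xs) \<le> weight I (last xs) \<and> finish (hd xs) \<le> finish (last xs)"
proof (induction xs)
  case (Cons x xs)
  then show ?case
    using weight_mono[of I x "hd xs"] edge_less[of I x "hd xs"]
    by (cases "xs = []") (auto simp: successively_Cons)
qed simp

lemma sorted_wrt_last: "sorted_wrt R xs \<Longrightarrow> x \<in> set xs \<Longrightarrow> x = last xs \<or> R x (last xs)"
  by (induction xs) auto

definition expose_step ::
  "interval \<Rightarrow> avl \<Rightarrow> interval option \<times> paths \<times> nat \<Rightarrow> interval option \<times> paths \<times> nat"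
where
  "expose_step i T = (\<lambda>(i', F, c).
     let (F1, c1) = split_ST (the i') F;
         (F2, c2) = join_ST i (the i') F1;
         (j, F3, c3) = max_ST (the i') F2
     in (right_compatible j T, F3, c + c1 + c2 + c3 + T_right_compatible j T))"

lemma expose_eq: "expose i T F =
    (let (j, F0, c0) = max_ST i F
     in map_option (\<lambda>(i', F, c). (F, c))
          (while_option (\<lambda>(i', F, c). i' \<noteq> None) (expose_step i T)
            (right_compatible j T, F0, c0 + T_right_compatible j T)))"
  unfolding expose_def expose_step_def ..

locale forest =
  fixes I :: "interval set" and T :: avl
  assumes good: "good I" and tree: "tree_of I T"
begin

sublocale solid I I
  using good good_finite by unfold_locales auto

text \<open>One iteration makes the dashed edge from \<open>j\<close> to \<open>p\<close> solid in place of the edge from some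
  sibling of \<open>j\<close>, whose ratio is at most \<open>1 - ratio I (j, p)\<close>.\<close>

lemma expose_step_spec:
  assumes F: "inv F" and m: "m \<in> I" and j: "j = last (path F m)" and p: "edge I j p"
  obtains F' c' j' where "expose_step m T (Some p, F, c) = (right_compatible j' T, F', c + c')"
    "inv F'" "j' = last (path F' m)" "j' \<in> I" "finish j < finish j'" "weight I p \<le> weight I j'"
    "c' + ranks F' - 28 * L * solidity I F' \<le>
       ranks F - 28 * L * solidity I F + 56 * L * (1 - ratio I (j, p))"
proof -
  have pI: "p \<in> I" "j \<in> I" "finish j < finish p"
    using edge_mem[OF good p] edge_less[OF good p] by auto
  have jm: "j \<in> set (path F m)"
    using path_props(1)[OF F m] j by (metis empty_iff empty_set last_in_set)
  have pm: "p \<notin> set (path F m)"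
  proof
    assume "p \<in> set (path F m)"
    then have "p = j \<or> p \<prec> j"
      using sorted_wrt_last[OF path_sorted[OF path_props(4)[OF F m]]] j by blast
    then show False
      using pI by (auto simp: prec_def)
  qed
  then have mp: "m \<notin> set (path F p)" and jp: "j \<notin> set (path F p)"
    using path_props(1)[OF F pI(1)] path_props(5)[OF F pI(1), of m] path_props(5)[OF F pI(1), of j]
      path_props(5)[OF F m jm] by metis+
  obtain F1 c1 xs ys where s: "path F p = xs @ p # ys" "split_ST p F = (F1, c1)" "inv F1"
    "\<And>y. path F1 y = (if y \<in> set xs then xs else if y \<in> set (p # ys) then p # ys else path F y)"
    "links F = links F1 \<union> (if xs = [] then {} else {(last xs, p)})"
    "c1 + ranks F1 \<le> ranks F + 4 * L"
    by (rule split_ST_spec[OF F pI(1)]) metis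
  have "p \<notin> set xs"
    using path_props(3)[OF F pI(1)] s(1) by simp
  then have p1: "path F1 p = p # ys"
    using s(4)[of p] by simp
  have m1: "path F1 m = path F m"
    using s(4)[of m] mp unfolding s(1) by simp
  obtain F2 c2 where t: "join_ST m p F1 = (F2, c2)" "inv F2"
    "path F2 m = path F1 m @ path F1 p" "path F2 p = path F1 m @ path F1 p"
    "links F2 = insert (last (path F1 m), hd (path F1 p)) (links F1)"
    "c2 + ranks F2 \<le> ranks F1 + 13 * L"
  proof (rule join_ST_spec[OF s(3) m pI(1)])
    show "p \<notin> set (path F1 m)" using pm m1 by simp
    show "edge I (last (path F1 m)) (hd (path F1 p))" using p p1 m1 j by simp
  qed
  obtain F3 c3 where u: "max_ST p F2 = (last (path F2 p), F3, c3)" "inv F3" "path F3 = path F2"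
    "links F3 = links F2" "c3 + ranks F3 \<le> ranks F2 + 8 * L"
    by (rule max_ST_spec[OF t(2) pI(1)])
  let ?j' = "last (path F2 p)"
  have j': "?j' = last (p # ys)"
    using t(4) p1 by simp
  have sc: "successively (edge I) (p # ys)"
    using path_props(4)[OF s(3) pI(1)] p1 by simp
  have rc: "real (T_right_compatible ?j' T) \<le> 3 * L"
    by (rule T_avl_lg[OF tree T_avl_bounds(6)])
  have links3: "links F3 = insert (j, p) (links F1)"
    using u(4) t(5) p1 m1 j by simp
  \<comment> \<open>\<open>j\<close> ends its path and so has no outgoing solid edge. Hence the join
    adds a genuinely new term to the sum of ratios.\<close>
  have "(j, p) \<notin> links F1"
  proof
    assume "(j, p) \<in> links F1"
    then have "(j, p) \<in> pairs (path F1 j)"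
      using links_path[OF s(3)] by blast
    moreover have "path F1 j = path F m"
      using path_props(5)[OF s(3) m] m1 jm by simp
    ultimately show False
      using pairs_last[of "path F m" j p] path_props(3)[OF F m] j by simp
  qed
  then have sol3: "solidity I F3 = ratio I (j, p) + solidity I F1"
    unfolding solidity_def links3 by (simp add: finite_links)
  have "solidity I F \<le> solidity I F1 + (1 - ratio I (j, p))"
  proof (cases "xs = []")
    case True
    then show ?thesis
      using s(5) ratio_bounds[OF good p] by (simp add: solidity_def)
  next
    case False
    have "(last xs, p) \<in> links F" "last xs \<in> set (path F p)"
      using s(1,5) False by auto
    then have e: "edge I (last xs) p" "last xs \<noteq> j"
      using links_rel[OF F] jp by auto
    have "solidity I F \<le> solidity I F1 + ratio I (last xs, p)"
      using s(5) False ratio_bounds[OF good e(1)]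
      by (simp add: solidity_def finite_links sum.insert_if)
    then show ?thesis
      using sibling_ratios[OF good e(1) p e(2)] by simp
  qed
  \<comment> \<open>With \<open>u = ratio I (j, p)\<close>, the split loses at most
    \<open>1 - u\<close> and the join gains \<open>u\<close>. Scaled by \<open>28 * L\<close>, this
    pays for the whole iteration up to \<open>56 * L * (1 - u)\<close>.\<close>
  then have "solidity I F + 2 * ratio I (j, p) - 1 \<le> solidity I F3"
    using sol3 by simp
  then have "28 * L * (solidity I F + 2 * ratio I (j, p) - 1) \<le> 28 * L * solidity I F3"
    using lg_ge_1[of "card I"] by (intro mult_left_mono) auto
  then have *: "28 * L + (- 28 * L * solidity I F3) \<le> - 28 * L * solidity I F + 56 * L * (1 - ratio I (j, p))"
    by (simp add: algebra_simps)
  show ?thesis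
  proof (rule that[of ?j' F3 "c1 + c2 + c3 + T_right_compatible ?j' T"])
    show "expose_step m T (Some p, F, c) =
        (right_compatible ?j' T, F3, c + (c1 + c2 + c3 + T_right_compatible ?j' T))"
      by (simp add: expose_step_def s(2) t(1) u(1))
    show "inv F3" by (rule u)
    show "?j' = last (path F3 m)"
      using u(3) t(3,4) by simp
    have "?j' \<in> set (path F1 p)"
      using j' p1 by (metis last_in_set list.distinct(1))
    then show "?j' \<in> I"
      using path_props(2)[OF s(3) pI(1)] by blast
    show "finish j < finish ?j'" "weight I p \<le> weight I ?j'"
      using weight_mono_path[OF good sc] pI(3) j' by auto
    show "real (c1 + c2 + c3 + T_right_compatible ?j' T) + ranks F3 - 28 * L * solidity I F3 \<le>
       ranks F - 28 * L * solidity I F + 56 * L * (1 - ratio I (j, p))"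
      using * rc u(5) t(6) s(6) by simp
  qed
qed

text \<open>Behind the new edge into \<open>p\<close>, the path continues along solid edges to
  \<open>j1\<close> without further iterations. Weights do not decrease on the way, so the
  logarithms still telescope. The loop ends because the last node of the path finishes later each
  time.\<close>

lemma expose_loop:
  assumes "inv F" "m \<in> I" "j = last (path F m)" "j \<in> I"
  shows "\<exists>i' F' c'. while_option (\<lambda>(i', F, c). i' \<noteq> None) (expose_step m T) (right_compatible j T, F, c)
      = Some (i', F', c + c') \<and> inv F' \<and> (\<nexists>y. edge I (last (path F' m)) y) \<and>
    c' + ranks F' - 28 * L * solidity I F' \<le>
      ranks F - 28 * L * solidity I F + 56 * L * (ln (card I) - ln (weight I j))"
  using assms
proof (induction "card {y \<in> I. finish j < finish y}" arbitrary: j F c rule: less_induct)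
  case less
  have w: "1 \<le> weight I j" "weight I j \<le> card I"
    using weight_ge_1[OF good less.prems(4)] weight_le_card[OF good less.prems(4)] by auto
  show ?case
  proof (cases "\<exists>p. edge I j p")
    case False
    then have "right_compatible j T = None"
      using right_compatible_iff[OF tree good less.prems(4)] by (metis not_None_eq)
    moreover have "0 \<le> 56 * L * (ln (card I) - ln (weight I j))"
      using w lg_ge_1[of "card I"] by (intro mult_nonneg_nonneg) auto
    ultimately show ?thesis
      using less.prems False
      by (intro exI[of _ None] exI[of _ F] exI[of _ 0]) (auto simp: while_option_unfold)
  next
    case True
    then obtain p where p: "edge I j p" ..
    obtain F1 c1 j1 where s: "expose_step m T (Some p, F, c) = (right_compatible j1 T, F1, c + c1)"
      "inv F1" "j1 = last (path F1 m)" "j1 \<in> I" "finish j < finish j1" "weight I p \<le> weight I j1"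
      "c1 + ranks F1 - 28 * L * solidity I F1 \<le>
         ranks F - 28 * L * solidity I F + 56 * L * (1 - ratio I (j, p))"
      by (rule expose_step_spec[OF less.prems(1-3) p])
    have "card {y \<in> I. finish j1 < finish y} < card {y \<in> I. finish j < finish y}"
      using s(4,5) finite_A by (intro psubset_card_mono) auto
    from less.hyps[OF this s(2) less.prems(2) s(3,4), of "c + c1"]
    obtain i' F' c' where r:
      "while_option (\<lambda>(i', F, c). i' \<noteq> None) (expose_step m T) (right_compatible j1 T, F1, c + c1)
        = Some (i', F', c + c1 + c')" "inv F'" "\<nexists>y. edge I (last (path F' m)) y"
      "c' + ranks F' - 28 * L * solidity I F' \<le>
        ranks F1 - 28 * L * solidity I F1 + 56 * L * (ln (card I) - ln (weight I j1))"
      by blast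
    have "right_compatible j T = Some p"
      using right_compatible_iff[OF tree good less.prems(4)] p by blast
    then have "while_option (\<lambda>(i', F, c). i' \<noteq> None) (expose_step m T) (right_compatible j T, F, c)
        = Some (i', F', c + (c1 + c'))"
      using r(1) s(1) by (subst while_option_unfold) (simp add: add.assoc)
    moreover have "real (c1 + c') + ranks F' - 28 * L * solidity I F' \<le>
      ranks F - 28 * L * solidity I F + 56 * L * (ln (card I) - ln (weight I j))"
    proof -
      have "1 \<le> weight I p"
        using weight_ge_1[OF good] edge_mem[OF good p] by blast
      then have "ln (weight I p) \<le> ln (weight I j1)"
        using s(6) by simp
      then have "1 - ratio I (j, p) \<le> ln (weight I j1) - ln (weight I j)"
        using one_minus_ratio_le[OF good p] by simp
      then have "56 * L * (1 - ratio I (j, p)) \<le> 56 * L * (ln (weight I j1) - ln (weight I j))"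
        using lg_ge_1[of "card I"] by (intro mult_left_mono) auto
      then show ?thesis
        using r(4) s(7) by (simp add: algebra_simps)
    qed
    ultimately show ?thesis
      using r(2,3) by blast
  qed
qed

text \<open>The first maximum and search cost 8 and 3. The telescoped logarithms are at most
  \<open>ln (card I) \<le> L\<close>, which turns \<open>56 * L\<close> into
  \<open>56 * L\<^sup>2\<close>.\<close>

lemma expose_spec:
  assumes "inv F" "m \<in> I"
  obtains F' c where "expose m T F = Some (F', c)" "inv F'" "\<nexists>y. edge I (last (path F' m)) y"
    "c + potential I F' \<le> potential I F + 11 * L + 56 * L\<^sup>2"
proof -
  obtain F0 c0 where s: "max_ST m F = (last (path F m), F0, c0)" "inv F0" "path F0 = path F"
    "links F0 = links F" "c0 + ranks F0 \<le> ranks F + 8 * L"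
    by (rule max_ST_spec[OF assms])
  let ?j = "last (path F m)"
  have j: "?j = last (path F0 m)" "?j \<in> I"
    using s(3) path_props(1,2)[OF assms] by (auto, metis empty_iff empty_set last_in_set subsetD)
  obtain i' F' c' where r: "while_option (\<lambda>(i', F, c). i' \<noteq> None) (expose_step m T)
      (right_compatible ?j T, F0, c0 + T_right_compatible ?j T)
      = Some (i', F', c0 + T_right_compatible ?j T + c')" "inv F'" "\<nexists>y. edge I (last (path F' m)) y"
    "c' + ranks F' - 28 * L * solidity I F' \<le>
      ranks F0 - 28 * L * solidity I F0 + 56 * L * (ln (card I) - ln (weight I ?j))"
    using expose_loop[OF s(2) assms(2) j] by blast
  have "expose m T F = Some (F', c0 + T_right_compatible ?j T + c')"
    using r(1) by (simp add: expose_eq s(1))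
  moreover have "real (c0 + T_right_compatible ?j T + c') + potential I F'
      \<le> potential I F + 11 * L + 56 * L\<^sup>2"
  proof -
    have "ln (card I) - ln (weight I ?j) \<le> L"
      using ln_le_lg[of "card I"] weight_ge_1[OF good j(2)] ln_ge_zero[of "weight I ?j"] by linarith
    then have "56 * L * (ln (card I) - ln (weight I ?j)) \<le> 56 * L * L"
      using lg_ge_1[of "card I"] by (intro mult_left_mono) auto
    moreover have "real (T_right_compatible ?j T) \<le> 3 * L"
      by (rule T_avl_lg[OF tree T_avl_bounds(6)])
    moreover have "solidity I F0 = solidity I F"
      using s(4) by (simp add: solidity_def)
    ultimately show ?thesis
      using r(4) s(5) by (simp add: potential_def algebra_simps power2_eq_square)
  qed
  ultimately show ?thesis
    using r(2,3) that by blast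
qed

end

section \<open>Queries and updates\<close>

definition is_root :: "interval set \<Rightarrow> interval \<Rightarrow> bool" where
  "is_root I x \<longleftrightarrow> (\<nexists>y. edge I x y)"

text \<open>The last conjunct records that the path of the minimum has been exposed up to a root. A
  query does not expose anything and relies on it.\<close>

definition state_ok :: "interval set \<Rightarrow> moncf \<Rightarrow> bool" where
  "state_ok I = (\<lambda>(T, F). forest I T \<and> solid_paths (edge I) I F \<and>
     (case tree_min T of None \<Rightarrow> True | Some m \<Rightarrow> is_root I (last (path F m))))"

lemma successively_mem:
  "successively R xs \<Longrightarrow> x \<in> set xs \<Longrightarrow> x = last xs \<or> (\<exists>y\<in>set xs. R x y)"
  by (induction R xs rule: successively.induct) auto

lemma successively_greedy:
  "successively (edge I) xs \<Longrightarrow> xs \<noteq> [] \<Longrightarrow> hd xs \<in> greedy I \<Longrightarrow> set xs \<subseteq> greedy I"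
proof (induction xs)
  case (Cons x xs)
  then show ?case
    using greedy.later[of x I "hd xs"] by (cases "xs = []") (auto simp: successively_Cons edge_def)
qed simp

context forest
begin

lemma T_tree_min_le: "real (T_tree_min T) \<le> 3 * L"
  by (rule T_avl_lg[OF tree T_avl_bounds(4)])

text \<open>The constant 70 is 3 for finding the minimum plus 11 and 56 from
  \<open>expose_spec\<close>, with \<open>L\<close> bounded by \<open>L\<^sup>2\<close>.\<close>

lemma expose_min_spec:
  assumes "inv F"
  obtains F' c where "expose_min T F = Some ((T, F'), c)" "state_ok I (T, F')"
    "c + potential I F' \<le> potential I F + 70 * L\<^sup>2"
proof -
  have L: "L \<le> L\<^sup>2" "1 \<le> L"
    using lg_ge_1[of "card I"] by (auto simp: power2_eq_square)
  show ?thesis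
  proof (cases rule: tree_min_cases[OF tree good])
    case 1
    show ?thesis
    proof (rule that[of F "T_tree_min T"])
      show "expose_min T F = Some ((T, F), T_tree_min T)"
        using 1 by (simp add: expose_min_def)
      show "state_ok I (T, F)"
        using 1 assms forest_axioms by (simp add: state_ok_def)
      show "T_tree_min T + potential I F \<le> potential I F + 70 * L\<^sup>2"
        using T_tree_min_le L by linarith
    qed
  next
    case (2 m)
    obtain F' c where e: "expose m T F = Some (F', c)" "inv F'" "\<nexists>y. edge I (last (path F' m)) y"
      "c + potential I F' \<le> potential I F + 11 * L + 56 * L\<^sup>2"
      by (rule expose_spec[OF assms 2(2)])
    show ?thesis
    proof (rule that[of F' "T_tree_min T + c"])
      show "expose_min T F = Some ((T, F'), T_tree_min T + c)"
        using 2 e(1) by (simp add: expose_min_def)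
      show "state_ok I (T, F')"
        using 2(1) e(2) e(3)[folded is_root_def] forest_axioms by (simp add: state_ok_def)
      show "real (T_tree_min T + c) + potential I F' \<le> potential I F + 70 * L\<^sup>2"
        using e(4) T_tree_min_le L by simp
    qed
  qed
qed

text \<open>Paths increase with respect to \<open>\<prec>\<close>, so the minimum heads its path. As
  the path ends in a root, it is closed under taking parents, which makes the induction over
  \<open>greedy\<close> go through.\<close>

lemma path_min_greedy:
  assumes "inv F" "m \<in> I" "\<And>k. k \<in> I \<Longrightarrow> finish m \<le> finish k"
    "is_root I (last (path F m))"
  shows "set (path F m) = greedy I"
proof
  note p = path_props(1-4)[OF assms(1,2)]
  have min: "is_arg_min finish (\<lambda>i. i \<in> I) x \<longleftrightarrow> x = m" for x
  proof
    assume "is_arg_min finish (\<lambda>i. i \<in> I) x"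
    then have "x \<in> I" "\<not> finish m < finish x"
      using assms(2) unfolding is_arg_min_def by blast+
    moreover from this have "finish x = finish m"
      using assms(3)[of x] by linarith
    ultimately show "x = m"
      using good_finish_eq[OF good _ assms(2)] by blast
  next
    assume "x = m"
    then show "is_arg_min finish (\<lambda>i. i \<in> I) x"
      using assms(2,3) unfolding is_arg_min_def not_less[symmetric] by blast
  qed
  have ne: "path F m \<noteq> []"
    using p(1) by auto
  have "hd (path F m) = m"
  proof (rule ccontr)
    assume "hd (path F m) \<noteq> m"
    then have "hd (path F m) \<prec> m"
      using path_sorted[OF p(4)] p(1) by (cases "path F m") auto
    moreover have "hd (path F m) \<in> I"
      using ne p(2) by auto
    ultimately show False
      using assms(3)[of "hd (path F m)"] by (simp add: prec_def)
  qed
  then show "set (path F m) \<subseteq> greedy I"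
    using successively_greedy[OF p(4) ne] greedy.first[of I m] min by simp
  show "greedy I \<subseteq> set (path F m)"
  proof
    fix x assume "x \<in> greedy I"
    then show "x \<in> set (path F m)"
    proof induction
      case (first x)
      then show ?case using min p(1) by simp
    next
      case (later x y)
      then have "edge I x y"
        using p(2) by (auto simp: edge_def)
      then have "x \<noteq> last (path F m)"
        using assms(4) unfolding is_root_def by blast
      then obtain z where "z \<in> set (path F m)" "edge I x z"
        using successively_mem[OF p(4) later.IH] by blast
      then show ?case
        using edge_det[OF good \<open>edge I x y\<close>] by blast
    qed
  qed
qed

lemma query_spec:
  assumes "state_ok I (T, F)"
  obtains F' c where "queryMonCF i (T, F) = (i \<in> greedy I, (T, F'), c)" "state_ok I (T, F')"
    "c + potential I F' \<le> potential I F + 11 * L"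
proof -
  have F: "inv F" and last: "\<And>m. tree_min T = Some m \<Longrightarrow> is_root I (last (path F m))"
    using assms by (auto simp: state_ok_def)
  show ?thesis
  proof (cases rule: tree_min_cases[OF tree good])
    case 1
    have "x \<notin> greedy I" for x
    proof
      assume "x \<in> greedy I"
      then show False
        using 1 by induction (auto simp: is_arg_min_def)
    qed
    then show ?thesis
      using 1 assms T_tree_min_le lg_ge_1[of "card I"]
      by (intro that[of F "T_tree_min T"]) (auto simp: queryMonCF_def)
  next
    case (2 m)
    obtain F' c where f: "find_ST m i F = (i \<in> set (path F m), F', c)" "inv F'" "path F' = path F"
      "links F' = links F" "c + ranks F' \<le> ranks F + 8 * L"
      by (rule find_ST_spec[OF F 2(2)])
    show ?thesis
    proof (rule that[of F' "T_tree_min T + c"])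
      show "queryMonCF i (T, F) = (i \<in> greedy I, (T, F'), T_tree_min T + c)"
        using 2 f(1) path_min_greedy[OF F 2(2,3) last[OF 2(1)]] by (simp add: queryMonCF_def)
      show "state_ok I (T, F')"
        using assms f(2,3) 2(1) by (simp add: state_ok_def)
      show "real (T_tree_min T + c) + potential I F' \<le> potential I F + 11 * L"
        using f(4,5) T_tree_min_le by (simp add: potential_def solidity_def)
    qed
  qed
qed

end

lemma (in insertion) solidity_change:
  assumes "solid_paths R A F" "\<And>a b. (a, b) \<in> links F \<Longrightarrow> edge I a b \<and> edge J a b"
  shows "\<bar>solidity I F - solidity J F\<bar> \<le> 2 + 4 * lg (card J)"
  using total_change[OF finite_links links_inj[OF assms(1)] assms(2)] ln_le_lg[of "card J"]
  unfolding solidity_def by linarith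

section \<open>Repairing the solid paths after an insertion or removal\<close>

definition cut_next :: "interval \<Rightarrow> avl \<Rightarrow> paths \<Rightarrow> paths \<times> nat" where
  "cut_next i T F =
    (case next_interval i T of
       None \<Rightarrow> (F, 0)
     | Some r \<Rightarrow>
         (let (p, F', c) = pred_ST r F
          in (case p of
                None \<Rightarrow> (F', c)
              | Some j \<Rightarrow>
                  if compatible j i
                  then (let (F'', c') = split_ST r F' in (F'', c + c'))
                  else (F', c))))"

lemma insertMonCF_eq: "insertMonCF i (T, F) =
    (let T' = avl_insert i T;
         (F1, c1) = cut_next i T' (if ST F i = \<langle>\<rangle> then \<langle>\<langle>\<rangle>, i, \<langle>\<rangle>\<rangle> # F else F)
     in map_option (\<lambda>(s, c). (s, T_avl_insert i T + T_next_interval i T' + c1 + c))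
          (expose_min T' F1))"
  unfolding insertMonCF_def cut_next_def Let_def prod.case ..

text \<open>Every solid edge broken by \<open>i\<close> enters the interval \<open>r\<close> next to
  \<open>i\<close>, and only one solid edge can enter \<open>r\<close>; testing its source, the
  predecessor of \<open>r\<close>, and splitting there suffices. The cut loses a ratio of at most 1.
  In the cost, the 1 is the rank of the new one-node tree and 12 is 8 for the predecessor plus 4 for
  the split.\<close>

lemma insert_cut:
  assumes "forest I T" and F: "solid_paths (edge I) I F" and J: "J = insert i I" and good_J: "good J"
    and tree: "tree_of J T'"
  defines "F0 \<equiv> if ST F i = \<langle>\<rangle> then \<langle>\<langle>\<rangle>, i, \<langle>\<rangle>\<rangle> # F else F"
  obtains F1 c1 where
    "cut_next i T' F0 = (F1, c1)"
    "solid_paths (edge J) J F1" "links F1 \<subseteq> links F" "solidity I F \<le> solidity I F1 + 1"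
    "c1 + ranks F1 \<le> ranks F + 1 + 12 * lg (card J)"
proof -
  have good_I: "good I"
    using assms(1) by (simp add: forest_def)
  interpret solid I J
    using good_I good_J good_finite by unfold_locales auto
  have L: "1 \<le> lg (card J)" by (rule lg_ge_1)
  have F0: "solid_paths (edge I) J F0 \<and> links F0 = links F \<and> ranks F0 \<le> ranks F + 1"
  proof (cases "i \<in> I")
    case True
    then have "ST F i \<noteq> \<langle>\<rangle>"
      using path_props(1)[OF F True] by (auto simp: path_def)
    then show ?thesis
      using True F J by (simp add: F0_def insert_absorb)
  next
    case False
    then have "J - {i} = I"
      using J by auto
    then show ?thesis
      using F J ST_empty[OF F False] by (simp add: F0_def pairs_Cons)
  qed
  have stable: "edge J a b" if "(a, b) \<in> links F" "\<not> (is_next J i b \<and> finish a < start i)" for a b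
  proof (cases "i \<in> I")
    case True
    then show ?thesis
      using links_rel[OF F that(1)] J by (simp add: insert_absorb)
  next
    case False
    interpret insertion I i
      using good_J False J by unfold_locales auto
    show ?thesis
    proof (rule ccontr)
      assume no: "\<not> edge J a b"
      have "is_next J i b \<longleftrightarrow> is_next I i b" if "b \<in> I"
        using that J by (auto simp: is_next_def prec_def)
      then show False
        using edge_I_cases[OF links_rel[OF F that(1)]] no that(2) J edge_mem[OF good_I links_rel[OF F that(1)]]
        by blast
    qed
  qed
  obtain F1 c1 where F1: "cut_next i T' F0 = (F1, c1)" "inv F1" "links F1 \<subseteq> links F"
    "\<And>a b. (a, b) \<in> links F1 \<Longrightarrow> \<not> (is_next J i b \<and> finish a < start i)"
    "solidity I F \<le> solidity I F1 + 1" "c1 + ranks F1 \<le> ranks F0 + 12 * lg (card J)"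
  proof (cases "next_interval i T'")
    case None
    have "\<not> is_next J i b" for b
      using None next_interval_iff[OF tree good_J, of i b] by simp
    then show thesis
      using None F0 L by (intro that[of F0 0]) (simp_all add: solidity_def cut_next_def)
  next
    case (Some r)
    have next_iff: "is_next J i b \<longleftrightarrow> b = r" for b
      using Some next_interval_iff[OF tree good_J, of i b] by (metis option.inject)
    then have r: "r \<in> J"
      unfolding is_next_def by blast
    obtain F2 c2 xs ys where p: "path F0 r = xs @ r # ys"
      "pred_ST r F0 = (if xs = [] then None else Some (last xs), F2, c2)" "inv F2" "path F2 = path F0"
      "links F2 = links F0" "c2 + ranks F2 \<le> ranks F0 + 8 * lg (card J)"
      by (rule pred_ST_spec[OF conjunct1[OF F0] r]) metis
    have dist: "distinct (xs @ r # ys)"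
      using path_props(3)[OF conjunct1[OF F0] r] p(1) by simp
    have link_r: "(a, r) \<in> pairs (xs @ r # ys)" if "(a, r) \<in> links F2" for a
      using links_path[OF p(3) that] p(1,4) by simp
    show thesis
    proof (cases "xs \<noteq> [] \<and> compatible (last xs) i")
      case True
      obtain F3 c3 us vs where s: "path F2 r = us @ r # vs" "split_ST r F2 = (F3, c3)" "inv F3"
        "\<And>y. path F3 y = (if y \<in> set us then us else if y \<in> set (r # vs) then r # vs else path F2 y)"
        "links F2 = links F3 \<union> (if us = [] then {} else {(last us, r)})"
        "c3 + ranks F3 \<le> ranks F2 + 4 * lg (card J)"
        by (rule split_ST_spec[OF p(3) r]) metis
      have "distinct (us @ r # vs)"
        using path_props(3)[OF p(3) r] s(1) by simp
      then have r3: "path F3 r = r # vs" "distinct (r # vs)"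
        using s(4)[of r] by auto
      show thesis
      proof (rule that[of F3 "c2 + c3"])
        show "cut_next i T' F0 = (F3, c2 + c3)"
          using Some p(2) True s(2) by (simp add: cut_next_def)
        show "inv F3" by (rule s)
        show "links F3 \<subseteq> links F"
          using s(5) p(5) F0 by blast
        show "\<not> (is_next J i b \<and> finish a < start i)" if "(a, b) \<in> links F3" for a b
        proof
          assume "is_next J i b \<and> finish a < start i"
          then have "b = r" using next_iff by simp
          then have "(a, r) \<in> pairs (r # vs)"
            using links_path[OF s(3) that] r3 by simp
          then show False
            using pairs_hd[OF r3(2), of a r] by simp
        qed
        show "solidity I F \<le> solidity I F3 + 1"
        proof (cases "us = []")
          case True
          then show ?thesis using s(5) p(5) F0 by (simp add: solidity_def)
        next
          case False
          then have "(last us, r) \<in> links F2" using s(5) by simp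
          then have "ratio I (last us, r) \<le> 1"
            using ratio_bounds(2)[OF good_I] links_rel[OF p(3)] by blast
          moreover have "links F = insert (last us, r) (links F3)"
            using s(5) p(5) F0 False by simp
          ultimately show ?thesis
            by (simp add: solidity_def finite_links sum.insert_if)
        qed
        show "real (c2 + c3) + ranks F3 \<le> ranks F0 + 12 * lg (card J)"
          using s(6) p(6) by simp
      qed
    next
      case False
      show thesis
      proof (rule that[of F2 c2])
        show "cut_next i T' F0 = (F2, c2)"
          using Some p(2) False by (auto simp: cut_next_def)
        show "inv F2" by (rule p)
        show "links F2 \<subseteq> links F"
          using p(5) F0 by simp
        show "\<not> (is_next J i b \<and> finish a < start i)" if "(a, b) \<in> links F2" for a b
        proof
          assume *: "is_next J i b \<and> finish a < start i"
          then have "b = r" using next_iff by simp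
          then have a: "(a, r) \<in> pairs (xs @ r # ys)"
            using link_r that by simp
          then have "xs \<noteq> []"
            using pairs_hd[OF dist, of a r] by auto
          then have "(last xs, r) \<in> pairs (xs @ r # ys)"
            by (simp add: pairs_append)
          \<comment> \<open>Only one solid edge enters \<open>r\<close>, so a broken one would come
            from the very predecessor that passed the test.\<close>
          then have "a = last xs"
            using pairs_inj[OF dist a] by blast
          then show False
            using False * \<open>xs \<noteq> []\<close> by (simp add: compatible_def)
        qed
        show "solidity I F \<le> solidity I F2 + 1"
          using p(5) F0 by (simp add: solidity_def)
        show "c2 + ranks F2 \<le> ranks F0 + 12 * lg (card J)"
          using p(6) L by simp
      qed
    qed
  qed
  show thesis
  proof (rule that[OF F1(1)])
    show "solid_paths (edge J) J F1"
      using stable F1(3,4) by (intro solid_paths_change_rel[OF F1(2)]) blast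
    show "links F1 \<subseteq> links F" "solidity I F \<le> solidity I F1 + 1"
      by (rule F1)+
    show "c1 + ranks F1 \<le> ranks F + 1 + 12 * lg (card J)"
      using F1(6) F0 by simp
  qed
qed

lemma state_ok_simp: "state_ok I (T, F) \<longleftrightarrow> forest I T \<and> solid_paths (edge I) I F \<and>
    (case tree_min T of None \<Rightarrow> True | Some m \<Rightarrow> is_root I (last (path F m)))"
  by (simp add: state_ok_def)

lemma insert_spec:
  assumes "state_ok I (T, F)" "good (insert i I)"
  obtains s c where "insertMonCF i (T, F) = Some (s, c)" "state_ok (insert i I) s"
    "c + potential (insert i I) (snd s) \<le> potential I F + 400 * (lg (card (insert i I)))\<^sup>2"
proof -
  define J where "J = insert i I"
  define L where "L = lg (card J)"
  have good: "good J" using assms(2) by (simp add: J_def)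
  have ok: "forest I T" "solid_paths (edge I) I F"
    using assms(1) by (simp_all add: state_ok_simp)
  then have I: "good I" "tree_of I T"
    by (simp_all add: forest_def)
  have tree: "tree_of J (avl_insert i T)"
    using tree_of_insert[OF I(2) assms(2)] by (simp add: J_def)
  interpret J: forest J "avl_insert i T"
    using good tree by unfold_locales
  have card: "card I \<le> card J"
    using good_finite[OF good] by (intro card_mono) (auto simp: J_def)
  have L: "1 \<le> L" "L \<le> L\<^sup>2" "1 \<le> L\<^sup>2" "lg (card I) \<le> L"
    using lg_ge_1[of "card J"] lg_mono[OF card] self_le_power[of L 2] one_le_power[of L 2]
    by (auto simp: L_def)
  obtain F1 c1 where cut:
    "cut_next i (avl_insert i T) (if ST F i = \<langle>\<rangle> then \<langle>\<langle>\<rangle>, i, \<langle>\<rangle>\<rangle> # F else F) = (F1, c1)"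
    "solid_paths (edge J) J F1" "links F1 \<subseteq> links F" "solidity I F \<le> solidity I F1 + 1"
    "c1 + ranks F1 \<le> ranks F + 1 + 12 * lg (card J)"
    by (rule insert_cut[OF ok J_def good tree])
  obtain F2 c2 where ex: "expose_min (avl_insert i T) F1 = Some ((avl_insert i T, F2), c2)"
    "state_ok J (avl_insert i T, F2)"
    "c2 + potential J F2 \<le> potential J F1 + 70 * (lg (card J))\<^sup>2"
    by (rule J.expose_min_spec[OF cut(2)])
  let ?c = "T_avl_insert i T + T_next_interval i (avl_insert i T) + c1 + c2"
  have "real (T_avl_insert i T) \<le> 3 * L" "real (T_next_interval i (avl_insert i T)) \<le> 3 * L"
    using T_avl_lg[OF I(2) T_avl_bounds(1), of i] T_avl_lg[OF tree T_avl_bounds(5), of i] L(4)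
    by (simp_all add: L_def)
  moreover have "potential J F1 \<le> potential I F + (ranks F1 - ranks F) + 56 + 112 * L + 112 * L\<^sup>2"
  proof -
    have sol: "0 \<le> solidity I F" "solidity I F \<le> card I"
      using solidity_bounds[OF I(1) ok(2)] .
    \<comment> \<open>The constant 4 is 1 for the new node, 1 for the edge that may be cut and 2
      from \<open>solidity_change\<close>.\<close>
    have J: "card J - solidity J F1 \<le> card I - solidity I F + (4 + 4 * L)" if "i \<notin> I"
    proof -
      interpret insertion I i
        using assms(2) that by unfold_locales auto
      have "\<bar>solidity I F1 - solidity J F1\<bar> \<le> 2 + 4 * lg (card J)"
        using solidity_change[of "edge J" J F1] cut(2) links_rel[OF cut(2)] links_rel[OF ok(2)] cut(3)
        unfolding J_def by blast
      moreover have "card J = card I + 1"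
        using that good_finite[OF I(1)] by (simp add: J_def)
      ultimately show ?thesis
        using cut(4) by (simp add: L_def)
    qed
    \<comment> \<open>The 56 is 28 times the 2 lost in \<open>lg_Suc\<close>, when the scale passes
      from \<open>card I\<close> to \<open>card J\<close>. If \<open>i\<close> was already present,
      the scale stays the same.\<close>
    have "28 * (L * (card J - solidity J F1)) \<le>
      28 * (lg (card I) * (card I - solidity I F)) + 56 + 28 * (L * (4 + 4 * L))"
    proof (cases "i \<in> I")
      case True
      then have "J = I" by (auto simp: J_def)
      then have "L * (card J - solidity J F1) \<le> L * (card I - solidity I F + (4 + 4 * L))"
        using cut(4) L by (intro mult_left_mono) auto
      then show ?thesis
        using \<open>J = I\<close> by (simp add: L_def distrib_left)
    next
      case False
      have "L * (card J - solidity J F1) \<le> L * (card I - solidity I F + (4 + 4 * L))"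
        using J[OF False] L by (intro mult_left_mono) auto
      also have "\<dots> = L * (card I - solidity I F) + L * (4 + 4 * L)"
        by (simp add: distrib_left)
      also have "L = lg (Suc (card I))"
        using False good_finite[OF I(1)] by (simp add: J_def L_def)
      then have "L * (card I - solidity I F) \<le> lg (card I) * (card I - solidity I F) + 2"
        using lg_Suc[where x = "card I - solidity I F" and n = "card I"] sol by simp
      finally show ?thesis by simp
    qed
    then show ?thesis
      by (simp add: potential_def L_def[symmetric] algebra_simps power2_eq_square)
  qed
  \<comment> \<open>The coefficients add up to 369: 3 + 3 for insertion and search, 1 + 12 for the
    cut, 70 for exposing and 56 + 112 + 112 for the potential. The bound 400 is a round number above
    this.\<close>
  ultimately have cost: "?c + potential J F2 \<le> potential I F + 400 * L\<^sup>2"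
    using ex(3)[folded L_def] cut(5)[folded L_def] L by simp
  show ?thesis
  proof (rule that)
    show "insertMonCF i (T, F) = Some ((avl_insert i T, F2), ?c)"
      using cut(1) ex(1) by (simp add: insertMonCF_eq Let_def)
    show "state_ok (insert i I) (avl_insert i T, F2)"
      using ex(2) by (simp add: J_def)
    show "?c + potential (insert i I) (snd (avl_insert i T, F2)) \<le>
        potential I F + 400 * (lg (card (insert i I)))\<^sup>2"
      using cost by (simp add: J_def L_def)
  qed
qed

text \<open>Only the solid edges at \<open>i\<close> itself disappear. All others avoid
  \<open>i\<close> and remain edges, while the orphaned children of \<open>i\<close> get dashed
  edges at no cost. The constant 4 is 2 for the deleted edges and 2 for the change of
  weights.\<close>

lemma delete_cut:
  assumes "good I" and F: "solid_paths (edge I) I F"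
  obtains F' c where "delete_ST i F = (F', c)" "solid_paths (edge (I - {i})) (I - {i}) F'"
    "card (I - {i}) - solidity (I - {i}) F' \<le> card I - solidity I F + (4 + 4 * lg (card I))"
    "c + ranks F' \<le> ranks F + 4 * lg (card I)"
proof (cases "i \<in> I")
  case False
  show ?thesis
  proof (rule that)
    show "delete_ST i F = (F, 1)"
      using ST_empty[OF F False] by (simp add: delete_ST_def)
  qed (use False F lg_ge_1[of "card I"] in simp_all)
next
  case True
  let ?I = "I - {i}"
  have eq: "insert i ?I = I"
    using True by blast
  interpret solid I I
    using assms good_finite by unfold_locales auto
  interpret insertion ?I i
    using assms(1) eq by unfold_locales auto
  obtain F' c xs ys where d: "path F i = xs @ i # ys" "delete_ST i F = (F', c)"
    "solid_paths (edge I) ?I F'"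
    "links F = links F' \<union> (if xs = [] then {} else {(last xs, i)}) \<union> (if ys = [] then {} else {(i, hd ys)})"
    "c + ranks F' \<le> ranks F + 4 * lg (card I)"
    by (rule delete_ST_spec[OF F True]) metis
  have stable: "edge ?I a b \<and> edge I a b" if "(a, b) \<in> links F'" for a b
    using links_subset[OF d(3) that] links_rel[OF d(3) that] edge_J_imp_I[of a b] eq by auto
  have le1: "ratio I e \<le> 1" if "e \<in> links F" for e
    using links_rel[OF F, of "fst e" "snd e"] ratio_bounds(2)[OF assms(1), of "fst e" "snd e"] that
    by simp
  have "solidity I F \<le> solidity I F' + 2"
  proof -
    let ?A = "if xs = [] then {} else {(last xs, i)}" and ?B = "if ys = [] then {} else {(i, hd ys)}"
    have nn: "0 \<le> ratio I e" for e
      by (cases e) (simp add: ratio_def weight_def)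
    have "sum (ratio I) ?A \<le> 1" "sum (ratio I) ?B \<le> 1"
      using le1 d(4) by auto
    moreover have "sum (ratio I) (links F) \<le> sum (ratio I) (links F') + sum (ratio I) ?A + sum (ratio I) ?B"
      unfolding d(4)
      by (intro order.trans[OF sum_Un_le] add_right_mono sum_Un_le) (auto simp: finite_links nn)
    ultimately show ?thesis
      by (simp add: solidity_def)
  qed
  moreover have "\<bar>solidity ?I F' - solidity I F'\<bar> \<le> 2 + 4 * lg (card I)"
    using solidity_change[OF d(3)] stable unfolding eq by blast
  moreover have "card ?I \<le> card I"
    using finite_A by (intro card_mono) auto
  ultimately have "card ?I - solidity ?I F' \<le> card I - solidity I F + (4 + 4 * lg (card I))"
    by simp
  moreover have "solid_paths (edge ?I) ?I F'"
    using stable by (intro solid_paths_change_rel[OF d(3)]) blast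
  ultimately show ?thesis
    using that[OF d(2)] d(5) by blast
qed

lemma remove_spec:
  assumes "state_ok I (T, F)"
  obtains s c where "removeMonCF i (T, F) = Some (s, c)" "state_ok (I - {i}) s"
    "c + potential (I - {i}) (snd s) \<le> potential I F + 400 * (lg (card I))\<^sup>2"
proof -
  let ?I = "I - {i}"
  define L where "L = lg (card I)"
  have ok: "forest I T" "solid_paths (edge I) I F"
    using assms(1) by (simp_all add: state_ok_simp)
  then have I: "good I" "tree_of I T"
    by (simp_all add: forest_def)
  have good: "good ?I"
    using good_subset[OF I(1)] by blast
  interpret I: forest ?I "avl_delete i T"
    using good tree_of_delete[OF I(2)] by unfold_locales
  have card: "card ?I \<le> card I"
    using good_finite[OF I(1)] by (intro card_mono) auto
  have L: "1 \<le> L" "L \<le> L\<^sup>2" "1 \<le> L\<^sup>2" "lg (card ?I) \<le> L" "0 \<le> lg (card ?I)"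
    using lg_ge_1[of "card I"] lg_ge_1[of "card ?I"] lg_mono[OF card] self_le_power[of L 2]
      one_le_power[of L 2]
    by (auto simp: L_def)
  obtain F1 c1 where cut: "delete_ST i F = (F1, c1)" "solid_paths (edge ?I) ?I F1"
    "card ?I - solidity ?I F1 \<le> card I - solidity I F + (4 + 4 * lg (card I))"
    "c1 + ranks F1 \<le> ranks F + 4 * lg (card I)"
    by (rule delete_cut[OF I(1) ok(2)])
  obtain F2 c2 where ex: "expose_min (avl_delete i T) F1 = Some ((avl_delete i T, F2), c2)"
    "state_ok ?I (avl_delete i T, F2)"
    "c2 + potential ?I F2 \<le> potential ?I F1 + 70 * (lg (card ?I))\<^sup>2"
    by (rule I.expose_min_spec[OF cut(2)])
  have "(lg (card ?I))\<^sup>2 \<le> L\<^sup>2"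
    using L by (intro power_mono) auto
  moreover have "real (T_avl_delete i T) \<le> 3 * L"
    using T_avl_lg[OF I(2) T_avl_bounds(3), of i] by (simp add: L_def)
  moreover have "potential ?I F1 \<le> potential I F + (ranks F1 - ranks F) + 112 * L + 112 * L\<^sup>2"
  proof -
    \<comment> \<open>The scale of the potential may shrink; since the deficit is nonnegative,
      replacing it by the old scale gives an upper bound.\<close>
    have "lg (card ?I) * (card ?I - solidity ?I F1) \<le> L * (card ?I - solidity ?I F1)"
      using L solidity_bounds[OF good cut(2)] by (intro mult_right_mono) auto
    also have "\<dots> \<le> L * (card I - solidity I F + (4 + 4 * L))"
      using L cut(3) by (intro mult_left_mono) (auto simp: L_def)
    finally show ?thesis
      by (simp add: potential_def L_def[symmetric] algebra_simps power2_eq_square)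
  qed
  \<comment> \<open>The coefficients add up to 4 + 3 + 70 + 112 + 112 = 301, below the round
    constant used for insertion.\<close>
  ultimately have cost: "c1 + T_avl_delete i T + c2 + potential ?I F2 \<le> potential I F + 400 * L\<^sup>2"
    using ex(3) cut(4)[folded L_def] L by linarith
  show ?thesis
  proof (rule that)
    show "removeMonCF i (T, F) = Some ((avl_delete i T, F2), c1 + T_avl_delete i T + c2)"
      using cut(1) ex(1) by (simp add: removeMonCF_def Let_def)
    show "state_ok (I - {i}) (avl_delete i T, F2)"
      by (rule ex)
    show "real (c1 + T_avl_delete i T + c2) + potential (I - {i}) (snd (avl_delete i T, F2)) \<le>
        potential I F + 400 * (lg (card I))\<^sup>2"
      using cost by (simp add: L_def)
  qed
qed

section \<open>Sequences of operations\<close>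

text \<open>The argument is the size before the operation, whereas \<open>insert_spec\<close> refers
  to the size afterwards; hence \<open>n + 1\<close>.\<close>

definition insert_cost :: "nat \<Rightarrow> real" where "insert_cost n = 400 * (lg (n + 1))\<^sup>2"
definition remove_cost :: "nat \<Rightarrow> real" where "remove_cost n = 400 * (lg n)\<^sup>2"
definition query_cost :: "nat \<Rightarrow> real" where "query_cost n = 11 * lg n"

lemma exec_spec:
  assumes "state_ok I s" "good (apply_op x I)"
  obtains b s' c where "exec x s = Some (b, s', c)" "state_ok (apply_op x I) s'"
    "\<And>i. x = Query i \<Longrightarrow> b = Some (i \<in> greedy I)"
    "c + potential (apply_op x I) (snd s') \<le>
      potential I (snd s) + charge insert_cost remove_cost query_cost x (card I)"
proof -
  obtain T F where s: "s = (T, F)" by (cases s)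
  interpret forest I T
    using assms(1) by (simp add: s state_ok_simp)
  show ?thesis
  proof (cases x)
    case (Insert i)
    obtain s' c where *: "insertMonCF i (T, F) = Some (s', c)" "state_ok (insert i I) s'"
      "c + potential (insert i I) (snd s') \<le> potential I F + 400 * (lg (card (insert i I)))\<^sup>2"
      using insert_spec[of I T F i] assms s Insert by auto
    have "card (insert i I) \<le> card I + 1"
      using good_finite[OF good] by (simp add: card_insert_if)
    then have "(lg (card (insert i I)))\<^sup>2 \<le> (lg (card I + 1))\<^sup>2"
      using lg_ge_1[of "card (insert i I)"] lg_mono by (intro power_mono) auto
    then show ?thesis
      using * by (intro that[of None s' c]) (simp_all add: Insert s insert_cost_def)
  next
    case (Remove i)
    obtain s' c where *: "removeMonCF i (T, F) = Some (s', c)" "state_ok (I - {i}) s'"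
      "c + potential (I - {i}) (snd s') \<le> potential I F + 400 * (lg (card I))\<^sup>2"
      using remove_spec[of I T F i] assms(1) s by auto
    then show ?thesis
      by (intro that[of None s' c]) (simp_all add: Remove s remove_cost_def)
  next
    case (Query i)
    obtain F' c where *: "queryMonCF i (T, F) = (i \<in> greedy I, (T, F'), c)" "state_ok I (T, F')"
      "c + potential I F' \<le> potential I F + 11 * L"
      using query_spec[of F i] assms(1) s by auto
    then show ?thesis
      by (intro that[of "Some (i \<in> greedy I)" "(T, F')" c]) (simp_all add: Query s query_cost_def)
  qed
qed

text \<open>The start state is arbitrary so that the induction can pass to the state after the first
  operation. The potentials of successive states telescope, and the final one is dropped as it is
  nonnegative.\<close>

lemma run_spec:
  assumes "state_ok I s" "\<forall>k\<le>length ops. good (fold apply_op (take k ops) I)"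
  shows "\<exists>tr. run ops s = Some tr \<and> length tr = length ops \<and>
    (\<forall>k<length ops. \<forall>i. ops ! k = Query i \<longrightarrow>
      fst (tr ! k) = Some (i \<in> greedy (fold apply_op (take k ops) I))) \<and>
    (\<Sum>k<length ops. real (snd (tr ! k))) \<le> potential I (snd s) +
      (\<Sum>k<length ops. charge insert_cost remove_cost query_cost (ops ! k) (card (fold apply_op (take k ops) I)))"
  using assms
proof (induction ops arbitrary: I s)
  case Nil
  have "good I" "solid_paths (edge I) I (snd s)"
    using Nil by (auto simp: state_ok_def)
  then show ?case
    using potential_nonneg by simp
next
  case (Cons x ops)
  have "good (fold apply_op (take 1 (x # ops)) I)"
    using Cons.prems(2) by (metis One_nat_def Suc_leI length_greater_0_conv list.distinct(1))
  then have "good (apply_op x I)" by simp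
  then obtain b s' c where e: "exec x s = Some (b, s', c)" "state_ok (apply_op x I) s'"
    "\<And>i. x = Query i \<Longrightarrow> b = Some (i \<in> greedy I)"
    "c + potential (apply_op x I) (snd s') \<le>
      potential I (snd s) + charge insert_cost remove_cost query_cost x (card I)"
    by (rule exec_spec[OF Cons.prems(1)]) metis
  have "\<forall>k\<le>length ops. good (fold apply_op (take k ops) (apply_op x I))"
  proof (intro allI impI)
    fix k assume "k \<le> length ops"
    then show "good (fold apply_op (take k ops) (apply_op x I))"
      using Cons.prems(2)[rule_format, of "Suc k"] by simp
  qed
  from Cons.IH[OF e(2) this] obtain tr where tr: "run ops s' = Some tr" "length tr = length ops"
    "\<forall>k<length ops. \<forall>i. ops ! k = Query i \<longrightarrow>
      fst (tr ! k) = Some (i \<in> greedy (fold apply_op (take k ops) (apply_op x I)))"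
    "(\<Sum>k<length ops. real (snd (tr ! k))) \<le> potential (apply_op x I) (snd s') +
      (\<Sum>k<length ops. charge insert_cost remove_cost query_cost (ops ! k)
        (card (fold apply_op (take k ops) (apply_op x I))))"
    by blast
  show ?case
  proof (intro exI[of _ "(b, c) # tr"] conjI)
    show "run (x # ops) s = Some ((b, c) # tr)"
      using e(1) tr(1) by simp
    show "length ((b, c) # tr) = length (x # ops)"
      using tr(2) by simp
    show "\<forall>k<length (x # ops). \<forall>i. (x # ops) ! k = Query i \<longrightarrow>
        fst (((b, c) # tr) ! k) = Some (i \<in> greedy (fold apply_op (take k (x # ops)) I))"
    proof (intro allI impI)
      fix k i assume "k < length (x # ops)" "(x # ops) ! k = Query i"
      then show "fst (((b, c) # tr) ! k) = Some (i \<in> greedy (fold apply_op (take k (x # ops)) I))"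
        using e(3)[of i] tr(3)[rule_format, of "k - 1" i] by (cases k) simp_all
    qed
    show "(\<Sum>k<length (x # ops). real (snd (((b, c) # tr) ! k))) \<le> potential I (snd s) +
        (\<Sum>k<length (x # ops). charge insert_cost remove_cost query_cost ((x # ops) ! k)
          (card (fold apply_op (take k (x # ops)) I)))"
      using e(4) tr(4) by (simp add: sum.lessThan_Suc_shift del: sum.lessThan_Suc)
  qed
qed

lemma finite_fold_apply_op: "finite I \<Longrightarrow> finite (fold apply_op ops I)"
proof (induction ops arbitrary: I)
  case (Cons x ops)
  then show ?case by (cases x) auto
qed simp

text \<open>From 3 on, \<open>n + 3 \<le> n * n\<close>, so the offsets inside the logarithm cost no
  more than a factor of 2.\<close>

lemma lg_bigo: "(\<lambda>n. lg (n + 1)) \<in> O(\<lambda>n. log 2 (real n))" "lg \<in> O(\<lambda>n. log 2 (real n))"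
proof -
  have *: "\<bar>lg (n + 1)\<bar> \<le> 2 * \<bar>log 2 (real n)\<bar> \<and> \<bar>lg n\<bar> \<le> 2 * \<bar>log 2 (real n)\<bar>" if "3 \<le> n" for n
  proof -
    have "n * 3 \<le> n * n"
      using that by simp
    then have "n + 3 \<le> n * n"
      using that by linarith
    then have "real n + 3 \<le> (real n)\<^sup>2"
      by (metis of_nat_add of_nat_le_iff of_nat_mult of_nat_numeral power2_eq_square)
    then have "log 2 (real n + 3) \<le> log 2 ((real n)\<^sup>2)"
      by (intro log_mono) auto
    then have "lg (n + 1) \<le> 2 * log 2 (real n)"
      using that by (simp add: lg_def log_nat_power add_ac)
    then show ?thesis
      using lg_mono[of n "n + 1"] lg_ge_1[of n] by simp
  qed
  show "(\<lambda>n. lg (n + 1)) \<in> O(\<lambda>n. log 2 (real n))" "lg \<in> O(\<lambda>n. log 2 (real n))"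
    using * by (auto intro!: bigoI[where c = 2] eventually_sequentiallyI[of 3])
qed

theorem theorem1:
  shows "\<exists>t_ins t_rem t_qry :: nat \<Rightarrow> real.
    t_ins \<in> O(\<lambda>n. (log 2 (real n))\<^sup>2) \<and>
    t_rem \<in> O(\<lambda>n. (log 2 (real n))\<^sup>2) \<and>
    t_qry \<in> O(\<lambda>n. log 2 (real n)) \<and>
    (\<forall>ops.
      (\<forall>k\<le>length ops. interval_set (current_set (take k ops)) \<and>
                       monotonic (current_set (take k ops))) \<longrightarrow>
      (\<exists>tr. run ops emptyMonCF = Some tr \<and>
            length tr = length ops \<and>
            (\<forall>k<length ops. \<forall>i. ops ! k = Query i \<longrightarrow>
               fst (tr ! k) = Some (i \<in> greedy (current_set (take k ops)))) \<and>
            (\<Sum>k<length ops. real (snd (tr ! k)))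
              \<le> (\<Sum>k<length ops.
                   charge t_ins t_rem t_qry (ops ! k) (card (current_set (take k ops))))))"
proof (rule exI[of _ insert_cost], rule exI[of _ remove_cost], rule exI[of _ query_cost], intro conjI allI impI)
  show "insert_cost \<in> O(\<lambda>n. (log 2 (real n))\<^sup>2)"
    unfolding insert_cost_def using landau_o.big_power[OF lg_bigo(1), of 2] by simp
  show "remove_cost \<in> O(\<lambda>n. (log 2 (real n))\<^sup>2)"
    unfolding remove_cost_def using landau_o.big_power[OF lg_bigo(2), of 2] by simp
  show "query_cost \<in> O(\<lambda>n. log 2 (real n))"
    unfolding query_cost_def using lg_bigo(2) by simp
next
  fix ops
  assume *: "\<forall>k\<le>length ops. interval_set (current_set (take k ops)) \<and>
    monotonic (current_set (take k ops))"
  have "good {}"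
    by (simp add: good_def interval_set_def monotonic_def)
  then have ok: "state_ok {} emptyMonCF"
    using tree_of_empty by (simp add: state_ok_def emptyMonCF_def forest_def)
  have "\<forall>k\<le>length ops. good (fold apply_op (take k ops) {})"
    using * finite_fold_apply_op by (simp add: good_def current_set_def)
  from run_spec[OF ok this]
  show "\<exists>tr. run ops emptyMonCF = Some tr \<and> length tr = length ops \<and>
      (\<forall>k<length ops. \<forall>i. ops ! k = Query i \<longrightarrow>
         fst (tr ! k) = Some (i \<in> greedy (current_set (take k ops)))) \<and>
      (\<Sum>k<length ops. real (snd (tr ! k))) \<le>
        (\<Sum>k<length ops. charge insert_cost remove_cost query_cost (ops ! k) (card (current_set (take k ops))))"
    \<comment> \<open>The empty structure has potential 0, so the total cost is bounded by the
      charges without an additive term.\<close>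
    by (simp add: current_set_def emptyMonCF_def potential_def solidity_def)
qed

end
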